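(* Let $c\ge 2$ be an integer and let $G$ be a graph on $n$ vertices which is the complement of a $c$-closed graph. Then the number of inclusion-maximal sets $S\subseteq V(G)$ such that $G[S]$ is a forest is at most $$n^3\,\mathcal{M}_0(c-1) + 2n^3 (c-1)\,\mathcal{F}(2c-3) \le 3n^3 (c-1)\cdot 1.8638^{2c-3}.$$
   Context: Graphs are finite, simple and undirected. A graph $H$ is $c$-closed if any two non-adjacent vertices have at most $c-1$ common neighbors; $G$ is the complement of a $c$-closed graph iff for any two adjacent vertices $u,v$ of $G$ at most $c-1$ vertices of $G$ are adjacent to neither $u$ nor $v$ (excluding $u,v$). $\mathcal{M}_0(N)$ is the maximum number of maximal independent sets in a graph on $N$ vertices, and $\mathcal{F}(N)$ is the maximum, over graphs $H$ on $N$ vertices, of the number of inclusion-maximal sets $S\subseteq V(H)$ with $H[S]$ a forest. *)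

theory Defs
  imports Complex_Main "HOL-Library.Ramsey"
begin

text \<open>A graph is given by its vertex set \<open>V\<close> and its set \<open>E\<close> of two-element edges.\<close>

definition simple_graph :: "'a set \<Rightarrow> 'a set set \<Rightarrow> bool" where
  "simple_graph V E \<longleftrightarrow> finite V \<and> E \<subseteq> [V]\<^bsup>2\<^esup>"

definition complement_edges :: "'a set \<Rightarrow> 'a set set \<Rightarrow> 'a set set" where
  "complement_edges V E = [V]\<^bsup>2\<^esup> - E"

definition induced_edges :: "'a set set \<Rightarrow> 'a set \<Rightarrow> 'a set set" where
  "induced_edges E S = {e \<in> E. e \<subseteq> S}"

definition c_closed :: "nat \<Rightarrow> 'a set \<Rightarrow> 'a set set \<Rightarrow> bool" where
  "c_closed c V E \<longleftrightarrow>
     (\<forall>u\<in>V. \<forall>v\<in>V. u \<noteq> v \<longrightarrow> {u, v} \<notin> E \<longrightarrow>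
        card {w \<in> V. {u, w} \<in> E \<and> {v, w} \<in> E} \<le> c - 1)"

text \<open>A cycle is the list of its vertices in cyclic order. The length bound matters: traversing
  one undirected edge back and forth is not a cycle. Isolated vertices lie on no cycle, so
  being a forest depends on the edge set only.\<close>

definition is_cycle :: "'a set set \<Rightarrow> 'a list \<Rightarrow> bool" where
  "is_cycle E p \<longleftrightarrow> 3 \<le> length p \<and> distinct p \<and>
     (\<forall>i<length p. {p ! i, p ! (Suc i mod length p)} \<in> E)"

definition forest :: "'a set set \<Rightarrow> bool" where
  "forest E \<longleftrightarrow> (\<nexists>p. is_cycle E p)"

definition maximal_subsets :: "'a set \<Rightarrow> ('a set \<Rightarrow> bool) \<Rightarrow> 'a set set" where
  "maximal_subsets V P = {S. S \<subseteq> V \<and> P S \<and> (\<forall>T. S \<subset> T \<and> T \<subseteq> V \<longrightarrow> \<not> P T)}"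

definition maximal_independent_sets :: "'a set \<Rightarrow> 'a set set \<Rightarrow> 'a set set" where
  "maximal_independent_sets V E = maximal_subsets V (\<lambda>S. indep S E)"

definition maximal_induced_forests :: "'a set \<Rightarrow> 'a set set \<Rightarrow> 'a set set" where
  "maximal_induced_forests V E = maximal_subsets V (\<lambda>S. forest (induced_edges E S))"

text \<open>Vertices are taken to be natural numbers in the next two definitions: every finite graph
  has an isomorphic copy of this kind.\<close>

definition M0 :: "nat \<Rightarrow> nat" where
  "M0 N = Max {card (maximal_independent_sets V E) | (V :: nat set) E.
                 simple_graph V E \<and> card V = N}"

definition F :: "nat \<Rightarrow> nat" where
  "F N = Max {card (maximal_induced_forests V E) | (V :: nat set) E.
                simple_graph V E \<and> card V = N}"

lemma complement_c_closed_iff: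
  assumes "simple_graph V H" and "E = complement_edges V H"
  shows "c_closed c V H \<longleftrightarrow>
    (\<forall>u\<in>V. \<forall>v\<in>V. {u, v} \<in> E \<longrightarrow>
       card {w \<in> V - {u, v}. {u, w} \<notin> E \<and> {v, w} \<notin> E} \<le> c - 1)"
proof -
  have H: "{x} \<notin> H" for x
    using assms(1) by (auto simp: simple_graph_def nsets_def)
  have eq: "{w \<in> V - {u, v}. {u, w} \<notin> E \<and> {v, w} \<notin> E} = {w \<in> V. {u, w} \<in> H \<and> {v, w} \<in> H}"
    if "u \<in> V" "v \<in> V" for u v
    using that H assms(2) by (auto simp: complement_edges_def nsets_def card_2_iff)
  have adj: "{u, v} \<in> E \<longleftrightarrow> u \<noteq> v \<and> {u, v} \<notin> H" if "u \<in> V" "v \<in> V" for u v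
    using that assms(2) by (auto simp: complement_edges_def nsets_def card_2_iff)
  show ?thesis
    unfolding c_closed_def using eq adj by auto
qed

lemma card_maximal_subsets_le:
  assumes "finite V"
  shows "card (maximal_subsets V P) \<le> 2 ^ card V"
proof -
  have "maximal_subsets V P \<subseteq> Pow V"
    by (auto simp: maximal_subsets_def)
  then have "card (maximal_subsets V P) \<le> card (Pow V)"
    using assms by (intro card_mono) auto
  then show ?thesis
    using assms by (simp add: card_Pow)
qed

lemma finite_maximal_subset_counts:
  "finite {card (maximal_subsets V (P E)) | (V :: nat set) E. simple_graph V E \<and> card V = N}"
  by (rule finite_subset[of _ "{..2 ^ N}"])
    (auto simp: simple_graph_def dest: card_maximal_subsets_le)

lemma M0_ge:
  fixes V :: "nat set"
  assumes "simple_graph V E"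
  shows "card (maximal_independent_sets V E) \<le> M0 (card V)"
  unfolding M0_def maximal_independent_sets_def
  using assms by (intro Max_ge finite_maximal_subset_counts[of "\<lambda>E S. indep S E"]) auto

lemma F_ge:
  fixes V :: "nat set"
  assumes "simple_graph V E"
  shows "card (maximal_induced_forests V E) \<le> F (card V)"
  unfolding F_def maximal_induced_forests_def
  using assms by (intro Max_ge finite_maximal_subset_counts[of "\<lambda>E S. forest (induced_edges E S)"]) auto

lemma simple_graph_exists: "simple_graph {..<N :: nat} {} \<and> card {..<N} = N"
  by (simp add: simple_graph_def)

lemma M0_attained:
  obtains V :: "nat set" and E where
    "simple_graph V E" "card V = N" "card (maximal_independent_sets V E) = M0 N"
proof -
  have "M0 N \<in> {card (maximal_independent_sets V E) | (V :: nat set) E.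
                 simple_graph V E \<and> card V = N}"
    unfolding M0_def maximal_independent_sets_def
    using simple_graph_exists[of N]
    by (intro Max_in finite_maximal_subset_counts[of "\<lambda>E S. indep S E"]) blast
  then show ?thesis using that by auto
qed

lemma F_attained:
  obtains V :: "nat set" and E where
    "simple_graph V E" "card V = N" "card (maximal_induced_forests V E) = F N"
proof -
  have "F N \<in> {card (maximal_induced_forests V E) | (V :: nat set) E.
                 simple_graph V E \<and> card V = N}"
    unfolding F_def maximal_induced_forests_def
    using simple_graph_exists[of N]
    by (intro Max_in finite_maximal_subset_counts[of "\<lambda>E S. forest (induced_edges E S)"]) blast
  then show ?thesis using that by auto
qed

end

theory Submission
  imports Defs
begin

text \<open>
  Write \<open>k = c - 1\<close>. A maximal induced forest \<open>S\<close> has either a vertex \<open>v\<close> such that \<open>S - {v}\<close> is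
  independent, or two disjoint edges. In the first case \<open>S - {v}\<close> is a maximal independent set of
  \<open>G - v\<close>, and there are at most \<open>n\<^sup>2 M0(k)\<close> of these: adding a vertex \<open>v\<close> to a graph creates a new
  maximal independent set only inside the common non-neighbourhood of an edge \<open>vw\<close>. In the second
  case the edges \<open>ab\<close>, \<open>cd\<close> can be chosen as the end edges of an induced path or with no edge between
  them, and then acyclicity forces \<open>S\<close> into \<open>{a,b,c,d}\<close> and the two common non-neighbourhoods.
  Contracting the components of \<open>G[{a,b,c,d}]\<close> turns \<open>S\<close> into a maximal induced forest of a
  graph on at most \<open>2k - 1\<close> vertices; there are at most \<open>n\<^sup>3 k\<close> choices of \<open>(a,b,c,d)\<close> as \<open>d\<close> is a
  common non-neighbour of \<open>a\<close> and \<open>b\<close>.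

  The bound \<open>F(N) \<le> 1.8638\<^sup>N\<close> is the measure-and-conquer argument of Fomin, Gaspers, Pyatkin and
  Razgon. One branches on vertices adjacent to a fixed connected part \<open>T\<close> of the forest
  \<open>D\<close> chosen so far. An undecided vertex has weight \<open>1\<close> if it closes a cycle with \<open>D\<close>, \<open>1.45\<close> if it is
  adjacent to \<open>T\<close>, and \<open>1.8638\<close> otherwise; the product of the weights bounds the number of maximal
  extensions of \<open>D\<close>.
\<close>

section \<open>Induced forests and connectivity\<close>

definition induces_forest :: "'a set set \<Rightarrow> 'a set \<Rightarrow> bool" where
  "induces_forest E S \<longleftrightarrow> forest (induced_edges E S)"

text \<open>The reflexive closure makes \<open>conn E S x x\<close> true even for \<open>x\<close>
  outside \<open>S\<close>, so membership is assumed separately wherever it matters.\<close>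

definition conn :: "'a set set \<Rightarrow> 'a set \<Rightarrow> 'a \<Rightarrow> 'a \<Rightarrow> bool" where
  "conn E S = (\<lambda>x y. x \<in> S \<and> y \<in> S \<and> {x, y} \<in> E)\<^sup>*\<^sup>*"

lemma conn_refl [simp]: "conn E S x x"
  by (simp add: conn_def)

lemma conn_trans: "conn E S x y \<Longrightarrow> conn E S y z \<Longrightarrow> conn E S x z"
  unfolding conn_def by (rule rtranclp_trans)

lemma conn_sym: "conn E S x y \<Longrightarrow> conn E S y x"
  unfolding conn_def
  by (rule sympD[OF symp_rtranclp]) (auto simp: symp_def insert_commute)

lemma conn_mono: "conn E S x y \<Longrightarrow> S \<subseteq> S' \<Longrightarrow> conn E S' x y"
  unfolding conn_def by (erule rtranclp_mono[THEN predicate2D, rotated]) auto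

lemma conn_edge: "x \<in> S \<Longrightarrow> y \<in> S \<Longrightarrow> {x, y} \<in> E \<Longrightarrow> conn E S x y"
  unfolding conn_def by auto

lemma conn_leaves:
  assumes "conn E S x y" "x \<in> C" "y \<notin> C"
  obtains u v where "u \<in> C" "v \<notin> C" "u \<in> S" "v \<in> S" "{u, v} \<in> E"
proof -
  have "y \<in> C \<or> (\<exists>u v. u \<in> C \<and> v \<notin> C \<and> u \<in> S \<and> v \<in> S \<and> {u, v} \<in> E)"
    using assms(1,2) unfolding conn_def by (induction rule: rtranclp_induct) auto
  then show thesis using that assms(3) by blast
qed

lemma conn_path:
  assumes "conn E S x y" "x \<in> S"
  obtains p where "p \<noteq> []" "hd p = x" "last p = y" "distinct p" "set p \<subseteq> S"
    "successively (\<lambda>a b. {a, b} \<in> E) p"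
proof -
  have "\<exists>p. p \<noteq> [] \<and> hd p = x \<and> last p = y \<and> distinct p \<and> set p \<subseteq> S
      \<and> successively (\<lambda>a b. {a, b} \<in> E) p"
    using assms unfolding conn_def
  proof (induction rule: rtranclp_induct)
    case base
    then show ?case by (intro exI[of _ "[x]"]) auto
  next
    case (step y z)
    then obtain p where p: "p \<noteq> []" "hd p = x" "last p = y" "distinct p" "set p \<subseteq> S"
      "successively (\<lambda>a b. {a, b} \<in> E) p" by auto
    \<comment> \<open>A step to a vertex already on the path cuts the path back to that vertex,
      which keeps it distinct.\<close>
    show ?case
    proof (cases "z \<in> set p")
      case True
      then obtain q r where pq: "p = q @ z # r" by (meson split_list)
      have "hd (q @ [z]) = x" using p(2) pq by (cases q) auto
      moreover have "successively (\<lambda>a b. {a, b} \<in> E) (q @ [z])"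
        using p(6) pq by (auto simp: successively_append_iff)
      ultimately show ?thesis using p pq by (intro exI[of _ "q @ [z]"]) auto
    next
      case False
      then show ?thesis using p step.hyps
        by (intro exI[of _ "p @ [z]"]) (auto simp: successively_append_iff)
    qed
  qed
  then show thesis using that by blast
qed

lemma successively_conn:
  "successively (\<lambda>a b. {a, b} \<in> E) p \<Longrightarrow> set p \<subseteq> S \<Longrightarrow> p \<noteq> [] \<Longrightarrow> conn E S (hd p) (last p)"
proof (induction p)
  case (Cons a p)
  show ?case
  proof (cases p)
    case (Cons b q)
    then have "conn E S a b" using Cons.prems by (auto intro: conn_edge)
    moreover have "conn E S b (last p)" using Cons Cons.IH Cons.prems by auto
    ultimately show ?thesis using Cons by (auto intro: conn_trans)
  qed simp
qed simp

section \<open>Cycles as closed paths, and adding one vertex to an induced forest\<close>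

lemma is_cycle_iff_successively:
  "is_cycle E p \<longleftrightarrow> 3 \<le> length p \<and> distinct p \<and> successively (\<lambda>a b. {a, b} \<in> E) p
     \<and> {last p, hd p} \<in> E"
proof (cases "3 \<le> length p")
  case True
  then have "p \<noteq> []" by auto
  have "(\<forall>i<length p. {p ! i, p ! (Suc i mod length p)} \<in> E) \<longleftrightarrow>
     (\<forall>i. Suc i < length p \<longrightarrow> {p ! i, p ! Suc i} \<in> E) \<and> {last p, hd p} \<in> E" (is "?L \<longleftrightarrow> ?R")
  proof
    assume L: ?L
    have "{p ! (length p - 1), p ! (Suc (length p - 1) mod length p)} \<in> E"
      using L True by (metis \<open>p \<noteq> []\<close> diff_less length_greater_0_conv zero_less_one)
    then show ?R using L \<open>p \<noteq> []\<close> by (auto simp: last_conv_nth hd_conv_nth) (metis Suc_lessD mod_less)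
  next
    assume R: ?R
    show ?L
    proof (intro allI impI)
      fix i assume "i < length p"
      then consider "Suc i < length p" | "i = length p - 1" by linarith
      then show "{p ! i, p ! (Suc i mod length p)} \<in> E"
        using R \<open>p \<noteq> []\<close> by cases (auto simp: last_conv_nth hd_conv_nth)
    qed
  qed
  then show ?thesis by (auto simp: is_cycle_def successively_conv_nth)
qed (auto simp: is_cycle_def)

text \<open>Indices modulo the length shift uniformly, so a cycle may be started at any of its
  vertices.\<close>

lemma is_cycle_rotate:
  assumes "is_cycle E p"
  shows "is_cycle E (rotate m p)"
proof -
  let ?n = "length p"
  have n: "3 \<le> ?n" using assms by (simp add: is_cycle_def)
  have "{rotate m p ! i, rotate m p ! (Suc i mod ?n)} \<in> E" if "i < ?n" for i
  proof -
    have "rotate m p ! i = p ! ((m + i) mod ?n)"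
      using that by (simp add: nth_rotate)
    moreover have "rotate m p ! (Suc i mod ?n) = p ! ((m + Suc i mod ?n) mod ?n)"
      using n by (intro nth_rotate mod_less_divisor) linarith
    moreover have "(m + Suc i mod ?n) mod ?n = Suc ((m + i) mod ?n) mod ?n"
      by (simp add: mod_simps)
    moreover have "(m + i) mod ?n < ?n" using n by (intro mod_less_divisor) linarith
    ultimately show ?thesis using assms by (auto simp: is_cycle_def)
  qed
  then show ?thesis using assms by (auto simp: is_cycle_def)
qed

lemma is_cycle_mono: "is_cycle E p \<Longrightarrow> E \<subseteq> E' \<Longrightarrow> is_cycle E' p"
  by (auto simp: is_cycle_def)

lemma is_cycle_induced_iff: "is_cycle (induced_edges E S) p \<longleftrightarrow> is_cycle E p \<and> set p \<subseteq> S"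
proof
  assume c: "is_cycle (induced_edges E S) p"
  have "set p \<subseteq> S"
  proof
    fix x assume "x \<in> set p"
    then obtain i where "i < length p" "p ! i = x" by (auto simp: in_set_conv_nth)
    then show "x \<in> S" using c by (auto simp: is_cycle_def induced_edges_def)
  qed
  moreover have "is_cycle E p" using c by (rule is_cycle_mono) (auto simp: induced_edges_def)
  ultimately show "is_cycle E p \<and> set p \<subseteq> S" by blast
next
  assume c: "is_cycle E p \<and> set p \<subseteq> S"
  then have "3 \<le> length p" by (auto simp: is_cycle_def)
  then have "p ! i \<in> S \<and> p ! (Suc i mod length p) \<in> S" if "i < length p" for i
    using c that by (auto intro!: subsetD[OF _ nth_mem] mod_less_divisor)
  then show "is_cycle (induced_edges E S) p"
    using c by (auto simp: is_cycle_def induced_edges_def)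
qed

lemma induces_forest_iff: "induces_forest E S \<longleftrightarrow> (\<nexists>p. is_cycle E p \<and> set p \<subseteq> S)"
  by (simp add: induces_forest_def forest_def is_cycle_induced_iff)

lemma induces_forest_mono: "induces_forest E S \<Longrightarrow> S' \<subseteq> S \<Longrightarrow> induces_forest E S'"
  unfolding induces_forest_iff by blast

text \<open>A cycle through \<open>v\<close> is a path in \<open>S\<close> between two distinct
  neighbours of \<open>v\<close>. Later proofs build forests vertex by vertex with this equivalence
  and hardly touch cycle lists.\<close>

lemma induces_forest_insert:
  assumes v: "v \<notin> S"
  shows "induces_forest E (insert v S) \<longleftrightarrow> induces_forest E S \<and>
    (\<forall>x\<in>S. \<forall>y\<in>S. {v, x} \<in> E \<longrightarrow> {v, y} \<in> E \<longrightarrow> conn E S x y \<longrightarrow> x = y)"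
proof (intro iffI conjI ballI impI)
  assume a: "induces_forest E (insert v S)"
  then show "induces_forest E S" by (rule induces_forest_mono) auto
  fix x y assume xy: "x \<in> S" "y \<in> S" "{v, x} \<in> E" "{v, y} \<in> E" "conn E S x y"
  show "x = y"
  proof (rule ccontr)
    assume "x \<noteq> y"
    obtain p where p: "p \<noteq> []" "hd p = x" "last p = y" "distinct p" "set p \<subseteq> S"
        "successively (\<lambda>a b. {a, b} \<in> E) p"
      using conn_path[OF xy(5,1)] .
    obtain q where q: "p = x # q" using p(1,2) by (cases p) auto
    have "q \<noteq> []" using q p \<open>x \<noteq> y\<close> by auto
    then have "is_cycle E (v # p)" using p q xy v
      by (auto simp: is_cycle_iff_successively Suc_le_eq insert_commute)
    then show False using a p(5) unfolding induces_forest_iff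
      by (metis insert_mono list.simps(15))
  qed
next
  assume a: "induces_forest E S \<and>
    (\<forall>x\<in>S. \<forall>y\<in>S. {v, x} \<in> E \<longrightarrow> {v, y} \<in> E \<longrightarrow> conn E S x y \<longrightarrow> x = y)"
  show "induces_forest E (insert v S)"
    unfolding induces_forest_iff
  proof
    assume "\<exists>p. is_cycle E p \<and> set p \<subseteq> insert v S"
    then obtain p where p: "is_cycle E p" "set p \<subseteq> insert v S" by blast
    have "v \<in> set p" using a p unfolding induces_forest_iff by blast
    then obtain i where i: "i < length p" "p ! i = v" by (auto simp: in_set_conv_nth)
    \<comment> \<open>Started at \<open>v\<close>, the cycle is \<open>v\<close> followed by a path
      \<open>r\<close> in \<open>S\<close> whose ends are neighbours of \<open>v\<close>. These ends
      are distinct because \<open>r\<close> has at least two vertices.\<close>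
    define q where "q = rotate i p"
    have q: "is_cycle E q" "set q \<subseteq> insert v S" using p is_cycle_rotate by (auto simp: q_def)
    have "hd q = v" using i by (subst q_def, subst hd_rotate_conv_nth) auto
    then obtain r where r: "q = v # r" using q(1) by (cases q) (auto simp: is_cycle_def)
    have r2: "r \<noteq> []" "distinct r" "v \<notin> set r" "set r \<subseteq> S" "2 \<le> length r"
      using q r by (auto simp: is_cycle_def)
    have e: "{v, hd r} \<in> E" "{v, last r} \<in> E" "successively (\<lambda>a b. {a, b} \<in> E) r"
      using q(1) r r2(1) unfolding is_cycle_iff_successively
      by (auto simp: successively_Cons insert_commute)
    have "hd r \<in> S" "last r \<in> S" using r2 by auto
    then have "hd r = last r"
      using a e successively_conn[OF e(3) r2(4,1)] by blast
    moreover obtain b s where "r = b # s" using r2(1) by (cases r) auto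
    moreover from this have "s \<noteq> []" using r2(5) by auto
    ultimately show False using r2(2) last_in_set[of s] by auto
  qed
qed

section \<open>Counting maximal extensions by branching\<close>

text \<open>Maximality is tested on single vertices, which suffices because subsets of forests are
  forests. It is tested only on \<open>U\<close>, so a set survives when vertices outside it are
  dropped from \<open>U\<close>; this is what lets branches be passed to smaller instances.\<close>

definition maximal_extensions :: "'a set set \<Rightarrow> 'a set \<Rightarrow> 'a set \<Rightarrow> 'a set set" where
  "maximal_extensions E D U = {S. D \<subseteq> S \<and> S \<subseteq> D \<union> U \<and> induces_forest E S
     \<and> (\<forall>x\<in>U - S. \<not> induces_forest E (insert x S))}"

lemma finite_maximal_extensions:
  "finite D \<Longrightarrow> finite U \<Longrightarrow> finite (maximal_extensions E D U)"
  by (rule finite_subset[of _ "Pow (D \<union> U)"]) (auto simp: maximal_extensions_def)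

lemma maximal_induced_forests_eq_extensions:
  "maximal_induced_forests V E = maximal_extensions E {} V"
proof -
  have "(\<forall>T. S \<subset> T \<and> T \<subseteq> V \<longrightarrow> \<not> induces_forest E T) \<longleftrightarrow>
      (\<forall>x\<in>V - S. \<not> induces_forest E (insert x S))" (is "?L \<longleftrightarrow> ?R") if "S \<subseteq> V" for S
  proof
    assume ?L
    show ?R
    proof
      fix x assume "x \<in> V - S"
      then show "\<not> induces_forest E (insert x S)" using \<open>?L\<close> that by auto
    qed
  next
    assume R: ?R
    show ?L
    proof (intro allI impI notI)
      fix T assume T: "S \<subset> T \<and> T \<subseteq> V" "induces_forest E T"
      then obtain x where "x \<in> T" "x \<notin> S" by blast
      then show False using R T induces_forest_mono[OF T(2), of "insert x S"] by auto
    qed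
  qed
  then show ?thesis
    unfolding maximal_induced_forests_def maximal_subsets_def maximal_extensions_def
      induces_forest_def[symmetric] by auto
qed

lemma maximal_extensions_drop:
  "S \<in> maximal_extensions E D U \<Longrightarrow> X \<inter> S = {} \<Longrightarrow> S \<in> maximal_extensions E D (U - X)"
  by (auto simp: maximal_extensions_def)

lemma maximal_extensions_take:
  "S \<in> maximal_extensions E D U \<Longrightarrow> v \<in> S \<Longrightarrow> X \<inter> S = {} \<Longrightarrow>
    S \<in> maximal_extensions E (insert v D) (U - {v} - X)"
  by (auto simp: maximal_extensions_def)

section \<open>Vertex weights and a single branching step\<close>

text \<open>Weight 1 is neutral in the product: a vertex closing a cycle with \<open>D\<close> lies
  in no extension and can be deleted at no cost. The value 1.45 is tuned to the branching rules
  below.\<close>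

definition wt :: "'a set set \<Rightarrow> 'a set \<Rightarrow> 'a set \<Rightarrow> 'a \<Rightarrow> real" where
  "wt E D T x = (if \<not> induces_forest E (insert x D) then 1
     else if \<exists>y\<in>T. {x, y} \<in> E then 1.45 else 1.8638)"

lemma wt_ge_1: "1 \<le> wt E D T x" and wt_le: "wt E D T x \<le> 1.8638"
  by (auto simp: wt_def)

lemma wt_pos: "0 < wt E D T x"
  using wt_ge_1[of E D T x] by linarith

lemma wt_antimono: "D \<subseteq> D' \<Longrightarrow> T \<subseteq> T' \<Longrightarrow> wt E D' T' x \<le> wt E D T x"
proof -
  assume a: "D \<subseteq> D'" "T \<subseteq> T'"
  have "induces_forest E (insert x D') \<Longrightarrow> induces_forest E (insert x D)"
    by (erule induces_forest_mono) (use a in auto)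
  then show ?thesis using a by (auto simp: wt_def)
qed

lemma card_Un3_le: "card (A \<union> B \<union> C) \<le> card A + card B + card C"
  by (meson add_mono card_Un_le le_refl le_trans)

lemma card_Un4_le: "card (A \<union> B \<union> C \<union> D) \<le> card A + card B + card C + card D"
  by (meson add_mono card_Un_le card_Un3_le le_refl le_trans)

text \<open>The state of one induction step, with the bound for fewer undecided vertices as
  \<open>IH\<close>. As a locale it can be instantiated with several connected parts
  \<open>T\<close> for the same \<open>D\<close> and \<open>U\<close>.\<close>

locale branching =
  fixes E :: "'a set set" and D T U :: "'a set"
  assumes finD: "finite D" and finU: "finite U" and disj: "D \<inter> U = {}"
    and TD: "T \<subseteq> D" and Tconn: "\<And>x y. x \<in> T \<Longrightarrow> y \<in> T \<Longrightarrow> conn E D x y"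
    and reduced: "\<And>x. x \<in> U \<Longrightarrow> induces_forest E (insert x D)"
    and IH: "\<And>D' T' U'. finite D' \<Longrightarrow> finite U' \<Longrightarrow> D' \<inter> U' = {} \<Longrightarrow> T' \<subseteq> D' \<Longrightarrow>
        (\<And>x y. x \<in> T' \<Longrightarrow> y \<in> T' \<Longrightarrow> conn E D' x y) \<Longrightarrow> card U' < card U \<Longrightarrow>
        real (card (maximal_extensions E D' U')) \<le> (\<Prod>x\<in>U'. wt E D' T' x)"
begin

abbreviation "w \<equiv> wt E D T"
abbreviation "P \<equiv> \<Prod>x\<in>U. w x"
definition "N = {x \<in> U. \<exists>y\<in>T. {x, y} \<in> E}"
text \<open>The generalized neighbours of \<open>v\<close> are the undecided vertices whose weight drops when \<open>v\<close> joins
  the forest. If \<open>v\<close> is left out, maximality forces one of them into the forest.\<close>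

definition "reach v = {y \<in> insert v D. conn E (insert v D) v y}"
definition "gnb v = {x \<in> U - {v}. if x \<in> N then \<not> induces_forest E (insert x (insert v D))
    else \<exists>y\<in>reach v. {x, y} \<in> E}"
text \<open>The factor guaranteed to leave the weight of a generalized neighbour \<open>x\<close>
  when \<open>v\<close> joins: from 1.45 to 1 inside \<open>N\<close>, from 1.8638 to at most 1.45
  outside.\<close>

definition "gain x = (if x \<in> N then 1.45 else 1.8638 / 1.45 :: real)"

lemma w_N: "x \<in> N \<Longrightarrow> w x = 1.45"
  using reduced by (auto simp: wt_def N_def)

lemma w_not_N: "x \<in> U \<Longrightarrow> x \<notin> N \<Longrightarrow> w x = 1.8638"
  using reduced by (auto simp: wt_def N_def)

lemma N_subset: "N \<subseteq> U" by (auto simp: N_def)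

lemma gnb_subset: "gnb v \<subseteq> U - {v}" by (auto simp: gnb_def)

lemma P_pos: "0 < P" by (intro prod_pos wt_pos ballI)

lemma drop_bound:
  assumes "X \<subseteq> U" "X \<noteq> {}"
  shows "real (card (maximal_extensions E D (U - X))) \<le> P / (\<Prod>x\<in>X. w x)"
proof -
  have "card (U - X) < card U" using assms finU by (intro psubset_card_mono) auto
  then have "real (card (maximal_extensions E D (U - X))) \<le> (\<Prod>x\<in>U - X. w x)"
    using finD finU disj TD Tconn by (intro IH) auto
  moreover have "P = (\<Prod>x\<in>U - X. w x) * (\<Prod>x\<in>X. w x)"
    using assms finU by (intro prod.subset_diff) auto
  moreover have "0 < (\<Prod>x\<in>X. w x)" by (intro prod_pos wt_pos ballI)
  ultimately show ?thesis by (simp add: field_simps)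
qed

text \<open>The weights of \<open>v\<close> and \<open>X\<close> leave the product, those in
  \<open>A\<close> shrink by the factor \<open>g\<close>, and all others can only decrease by
  \<open>wt_antimono\<close>. The set \<open>A\<close> need not contain every vertex whose weight
  drops.\<close>

lemma take_bound:
  assumes v: "v \<in> U" and X: "X \<subseteq> U - {v}" and A: "A \<subseteq> U - {v} - X"
    and T': "T \<subseteq> T'" "T' \<subseteq> insert v D" "\<And>x y. x \<in> T' \<Longrightarrow> y \<in> T' \<Longrightarrow> conn E (insert v D) x y"
    and g: "\<And>x. x \<in> A \<Longrightarrow> 0 < g x" "\<And>x. x \<in> A \<Longrightarrow> wt E (insert v D) T' x * g x \<le> w x"
  shows "real (card (maximal_extensions E (insert v D) (U - {v} - X)))
    \<le> P / (w v * (\<Prod>x\<in>X. w x) * (\<Prod>x\<in>A. g x))"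
proof -
  let ?U = "U - {v} - X" and ?w = "wt E (insert v D) T'"
  have "card ?U < card U" using v finU by (intro psubset_card_mono) auto
  then have "real (card (maximal_extensions E (insert v D) ?U)) \<le> (\<Prod>x\<in>?U. ?w x)"
    using finD finU disj T' by (intro IH) auto
  also have "\<dots> = (\<Prod>x\<in>?U - A. ?w x) * (\<Prod>x\<in>A. ?w x)"
    using A finU by (intro prod.subset_diff) auto
  also have "\<dots> \<le> (\<Prod>x\<in>?U - A. w x) * (\<Prod>x\<in>A. w x / g x)"
  proof (intro mult_mono prod_mono conjI)
    fix x assume "x \<in> A"
    then show "?w x \<le> w x / g x" using g by (simp add: pos_le_divide_eq)
  qed (auto intro!: prod_nonneg wt_antimono wt_pos[THEN less_imp_le] T'(1) divide_nonneg_nonneg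
      g(1)[THEN less_imp_le])
  also have "\<dots> = (\<Prod>x\<in>?U - A. w x) * (\<Prod>x\<in>A. w x) / (\<Prod>x\<in>A. g x)"
    by (simp add: prod_dividef)
  also have "(\<Prod>x\<in>?U - A. w x) * (\<Prod>x\<in>A. w x) = (\<Prod>x\<in>?U. w x)"
    using A finU by (intro prod.subset_diff[symmetric]) auto
  also have "(\<Prod>x\<in>?U. w x) = P / (w v * (\<Prod>x\<in>X. w x))"
  proof -
    have "P = w v * (\<Prod>x\<in>U - {v}. w x)" using v finU by (rule prod.remove[rotated])
    moreover have "(\<Prod>x\<in>U - {v}. w x) = (\<Prod>x\<in>?U. w x) * (\<Prod>x\<in>X. w x)"
      using X finU by (intro prod.subset_diff) auto
    moreover have "0 < (\<Prod>x\<in>X. w x)" by (intro prod_pos wt_pos ballI)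
    ultimately show ?thesis using wt_pos[of E D T v] by (simp add: field_simps)
  qed
  finally show ?thesis by simp
qed

lemma take_far_bound:
  assumes "v \<in> U" "X \<subseteq> U - {v}"
  shows "real (card (maximal_extensions E (insert v D) (U - {v} - X))) \<le> P / (w v * (\<Prod>x\<in>X. w x))"
proof -
  have "conn E (insert v D) x y" if "x \<in> T" "y \<in> T" for x y
    using Tconn[OF that] by (rule conn_mono) auto
  then show ?thesis using take_bound[OF assms, of "{}" T] TD by auto
qed

text \<open>A vertex of \<open>N\<close> is adjacent to the connected set \<open>T\<close>, so its
  component in \<open>insert v D\<close> absorbs \<open>T\<close> and may replace it as the
  distinguished connected part.\<close>

lemma T_subset_reach:
  assumes "v \<in> N"
  shows "T \<subseteq> reach v"
proof
  fix y assume y: "y \<in> T"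
  obtain t where t: "t \<in> T" "{v, t} \<in> E" using assms by (auto simp: N_def)
  have "conn E (insert v D) v t" using t TD by (intro conn_edge) auto
  moreover have "conn E (insert v D) t y" using Tconn[OF t(1) y] by (rule conn_mono) auto
  ultimately show "y \<in> reach v" using y TD by (auto simp: reach_def intro: conn_trans)
qed

lemma reach_conn: "x \<in> reach v \<Longrightarrow> y \<in> reach v \<Longrightarrow> conn E (insert v D) x y"
  by (auto simp: reach_def intro: conn_trans conn_sym)

text \<open>Inside \<open>N\<close> the relation says that \<open>D\<close> together with both
  vertices contains a cycle, which is symmetric.\<close>

lemma gnb_sym: "v \<in> N \<Longrightarrow> x \<in> N \<Longrightarrow> x \<in> gnb v \<longleftrightarrow> v \<in> gnb x"
  using N_subset by (auto simp: gnb_def insert_commute)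

lemma gain_ge: "1.8638 / 1.45 \<le> gain x" and gain_pos: "0 < gain x"
  by (simp_all add: gain_def)

lemma take_near_bound:
  assumes "v \<in> N" "X \<subseteq> U - {v}" "A \<subseteq> gnb v - X"
  shows "real (card (maximal_extensions E (insert v D) (U - {v} - X)))
    \<le> P / (1.45 * (\<Prod>x\<in>X. w x) * (\<Prod>x\<in>A. gain x))"
proof -
  have "wt E (insert v D) (reach v) x * gain x \<le> w x" if "x \<in> gnb v" for x
  proof -
    have "x \<in> U" using that by (auto simp: gnb_def)
    show ?thesis
    proof (cases "x \<in> N")
      case True
      then have "wt E (insert v D) (reach v) x = 1" using that by (simp add: gnb_def wt_def)
      then show ?thesis using w_N[OF True] True by (simp add: gain_def)
    next
      case False
      then have "wt E (insert v D) (reach v) x \<le> 1.45" using that by (auto simp: gnb_def wt_def)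
      then show ?thesis using w_not_N[OF \<open>x \<in> U\<close> False] False by (simp add: gain_def)
    qed
  qed
  then have "real (card (maximal_extensions E (insert v D) (U - {v} - X)))
    \<le> P / (w v * (\<Prod>x\<in>X. w x) * (\<Prod>x\<in>A. gain x))"
  proof (intro take_bound[where T' = "reach v"])
    show "reach v \<subseteq> insert v D" by (auto simp: reach_def)
  qed (use assms gnb_subset[of v] N_subset T_subset_reach[OF assms(1)] reach_conn[of _ v]
      in \<open>auto simp: gain_pos\<close>)
  then show ?thesis unfolding w_N[OF assms(1)] .
qed

text \<open>By maximality \<open>v\<close> closes a cycle with \<open>S\<close>, whereas
  \<open>insert v D\<close> is a forest. Hence the cycle uses a vertex outside \<open>D\<close>, and
  the first such vertex next to the component of \<open>v\<close> is a generalized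
  neighbour.\<close>

lemma gnb_hit:
  assumes S: "S \<in> maximal_extensions E D U" and v: "v \<in> N" "v \<notin> S"
  shows "gnb v \<inter> S \<noteq> {}"
proof
  assume no: "gnb v \<inter> S = {}"
  have vU: "v \<in> U" and vD: "v \<notin> D" using v N_subset disj by auto
  have DS: "D \<subseteq> S" "S \<subseteq> D \<union> U" using S by (auto simp: maximal_extensions_def)
  have fvD: "induces_forest E (insert v D)" using reduced vU .
  obtain t where t: "t \<in> T" "t \<in> D" "{v, t} \<in> E" using v TD by (auto simp: N_def)
  obtain x y where xy: "x \<in> S" "y \<in> S" "{v, x} \<in> E" "{v, y} \<in> E" "conn E S x y" "x \<noteq> y"
    using S vU v(2) induces_forest_insert[OF v(2), of E] by (auto simp: maximal_extensions_def)
  \<comment> \<open>A vertex of \<open>N\<close> must close a cycle to be a generalized neighbour,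
    hence the demand for a second neighbour in \<open>reach v\<close>; outside \<open>N\<close> one
    neighbour is enough.\<close>
  have key: False if z: "z \<in> S" "z \<in> U" "y0 \<in> reach v" "{z, y0} \<in> E"
    and two: "z \<in> N \<Longrightarrow> \<exists>y1\<in>reach v. y1 \<noteq> y0 \<and> {z, y1} \<in> E" for z y0
  proof -
    have zv: "z \<noteq> v" "z \<notin> insert v D" using z v disj by auto
    have "z \<in> gnb v"
    proof (cases "z \<in> N")
      case True
      then obtain y1 where y1: "y1 \<in> reach v" "y1 \<noteq> y0" "{z, y1} \<in> E" using two by blast
      have "y0 \<in> insert v D" "y1 \<in> insert v D" using z y1 by (auto simp: reach_def)
      then have "\<not> induces_forest E (insert z (insert v D))"
        using induces_forest_insert[OF zv(2), of E] reach_conn[OF z(3) y1(1)] z(4) y1 by auto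
      then show ?thesis using z zv True by (auto simp: gnb_def)
    qed (use z zv in \<open>auto simp: gnb_def\<close>)
    then show False using no z by blast
  qed
  have vreach: "v \<in> reach v" by (auto simp: reach_def)
  \<comment> \<open>A neighbour of \<open>v\<close> in \<open>S\<close> outside \<open>D\<close>
    would be such a \<open>z\<close>; if it is in \<open>N\<close>, its neighbour in
    \<open>T\<close> is the second one, distinct from \<open>v\<close> because \<open>v\<close> is
    not in \<open>D\<close>.\<close>
  have inD: "z \<in> D" if "z \<in> S" "{v, z} \<in> E" for z
  proof (rule ccontr)
    assume "z \<notin> D"
    show False
    proof (rule key[of z v])
      show "z \<in> N \<Longrightarrow> \<exists>y1\<in>reach v. y1 \<noteq> v \<and> {z, y1} \<in> E"
        using T_subset_reach[OF v(1)] TD vD by (auto simp: N_def)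
    qed (use that \<open>z \<notin> D\<close> DS vreach in \<open>auto simp: insert_commute\<close>)
  qed
  \<comment> \<open>The connection from \<open>p\<close> leaves the component of \<open>p\<close> in
    \<open>D\<close> along an edge \<open>uz\<close> with \<open>z\<close> outside \<open>D\<close>.
    As this component avoids \<open>t\<close>, a neighbour of \<open>z\<close> in \<open>T\<close>
    differs from \<open>u\<close>.\<close>
  have leave: False if p: "p \<in> D" "{v, p} \<in> E" "conn E S p q" "\<not> conn E D p q" "\<not> conn E D p t"
    for p q
  proof -
    obtain u z where uz: "u \<in> {z \<in> D. conn E D p z}" "z \<notin> {z \<in> D. conn E D p z}"
      "u \<in> S" "z \<in> S" "{u, z} \<in> E"
      using conn_leaves[OF p(3), of "{z \<in> D. conn E D p z}"] p by auto
    have "z \<notin> D" using uz by (auto intro: conn_trans conn_edge)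
    have "conn E (insert v D) v p" using p by (intro conn_edge) auto
    moreover have "conn E (insert v D) p u" using uz by (auto intro: conn_mono)
    ultimately have ureach: "u \<in> reach v" using uz by (auto simp: reach_def intro: conn_trans)
    show False
    proof (rule key[of z u])
      assume "z \<in> N"
      then obtain t1 where t1: "t1 \<in> T" "{z, t1} \<in> E" by (auto simp: N_def)
      have "t1 \<noteq> u" using uz(1) Tconn[OF t1(1) t(1)] p(5) by (auto intro: conn_trans)
      then show "\<exists>y1\<in>reach v. y1 \<noteq> u \<and> {z, y1} \<in> E" using t1 T_subset_reach[OF v(1)] by blast
    qed (use uz \<open>z \<notin> D\<close> DS ureach in \<open>auto simp: insert_commute\<close>)
  qed
  have D: "x \<in> D" "y \<in> D" using inD xy by auto
  have nc: "\<not> conn E D x y"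
    using fvD D xy induces_forest_insert[OF vD, of E] by blast
  \<comment> \<open>At least one of the two components is not the one containing \<open>t\<close>,
    and \<open>leave\<close> applies to that one.\<close>
  then have "\<not> conn E D x t \<or> \<not> conn E D y t" by (meson conn_sym conn_trans)
  then show False using leave[of x y] leave[of y x] nc D xy by (metis conn_sym)
qed


section \<open>Branching rules by the number of generalized neighbours\<close>

lemma extensions_cover2:
  assumes "\<And>S. S \<in> maximal_extensions E D U \<Longrightarrow>
      S \<in> maximal_extensions E D1 U1 \<or> S \<in> maximal_extensions E D2 U2"
    and "finite D1" "finite D2" "finite U1" "finite U2"
  shows "card (maximal_extensions E D U) \<le>
      card (maximal_extensions E D1 U1) + card (maximal_extensions E D2 U2)"
  using assms by (intro order_trans[OF card_mono card_Un_le])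
    (auto intro!: finite_maximal_extensions)

lemma extensions_cover3:
  assumes "\<And>S. S \<in> maximal_extensions E D U \<Longrightarrow>
      S \<in> maximal_extensions E D1 U1 \<or> S \<in> maximal_extensions E D2 U2 \<or> S \<in> maximal_extensions E D3 U3"
    and "finite D1" "finite D2" "finite D3" "finite U1" "finite U2" "finite U3"
  shows "card (maximal_extensions E D U) \<le> card (maximal_extensions E D1 U1) +
      card (maximal_extensions E D2 U2) + card (maximal_extensions E D3 U3)"
  using assms by (intro order_trans[OF card_mono card_Un3_le])
    (auto intro!: finite_maximal_extensions)

lemma extensions_cover4:
  assumes "\<And>S. S \<in> maximal_extensions E D U \<Longrightarrow>
      S \<in> maximal_extensions E D1 U1 \<or> S \<in> maximal_extensions E D2 U2 \<or>
      S \<in> maximal_extensions E D3 U3 \<or> S \<in> maximal_extensions E D4 U4"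
    and "finite D1" "finite D2" "finite D3" "finite D4" "finite U1" "finite U2" "finite U3" "finite U4"
  shows "card (maximal_extensions E D U) \<le> card (maximal_extensions E D1 U1) +
      card (maximal_extensions E D2 U2) + card (maximal_extensions E D3 U3) +
      card (maximal_extensions E D4 U4)"
  using assms by (intro order_trans[OF card_mono card_Un4_le])
    (auto intro!: finite_maximal_extensions)

lemma split_vertex:
  "card (maximal_extensions E D U) \<le>
     card (maximal_extensions E (insert v D) (U - {v} - {})) + card (maximal_extensions E D (U - {v}))"
  using maximal_extensions_take[of _ E D U v "{}"] maximal_extensions_drop[of _ E D U "{v}"] finD finU
  by (intro extensions_cover2) auto

lemma split_gnb1:
  assumes v: "v \<in> N" "gnb v = {x}"
  shows "card (maximal_extensions E D U) \<le>
     card (maximal_extensions E (insert v D) (U - {v} - {})) +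
     card (maximal_extensions E (insert x D) (U - {x} - {v}))"
proof (rule extensions_cover2)
  fix S assume S: "S \<in> maximal_extensions E D U"
  show "S \<in> maximal_extensions E (insert v D) (U - {v} - {}) \<or>
     S \<in> maximal_extensions E (insert x D) (U - {x} - {v})"
    using maximal_extensions_take[OF S, of v "{}"] maximal_extensions_take[OF S, of x "{v}"]
      gnb_hit[OF S v(1)] v(2) by auto
qed (use finD finU in auto)

text \<open>Extensions omitting \<open>v\<close> are sorted by the first generalized neighbour, in
  the order \<open>x\<close>, \<open>y\<close>, that they contain; those passed over are dropped, so
  their weights are divided out too.\<close>

lemma split_gnb2:
  assumes v: "v \<in> N" "gnb v = {x, y}"
  shows "card (maximal_extensions E D U) \<le>
     card (maximal_extensions E (insert v D) (U - {v} - {})) +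
     card (maximal_extensions E (insert x D) (U - {x} - {v})) +
     card (maximal_extensions E (insert y D) (U - {y} - {v, x}))"
proof (rule extensions_cover3)
  fix S assume S: "S \<in> maximal_extensions E D U"
  show "S \<in> maximal_extensions E (insert v D) (U - {v} - {}) \<or>
     S \<in> maximal_extensions E (insert x D) (U - {x} - {v}) \<or>
     S \<in> maximal_extensions E (insert y D) (U - {y} - {v, x})"
    using maximal_extensions_take[OF S, of v "{}"] maximal_extensions_take[OF S, of x "{v}"]
      maximal_extensions_take[OF S, of y "{v, x}"] gnb_hit[OF S v(1)] v(2) by auto
qed (use finD finU in auto)

lemma split_gnb3:
  assumes v: "v \<in> N" "gnb v = {x, y, z}"
  shows "card (maximal_extensions E D U) \<le>
     card (maximal_extensions E (insert v D) (U - {v} - {})) +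
     card (maximal_extensions E (insert x D) (U - {x} - {v})) +
     card (maximal_extensions E (insert y D) (U - {y} - {v, x})) +
     card (maximal_extensions E (insert z D) (U - {z} - {v, x, y}))"
proof (rule extensions_cover4)
  fix S assume S: "S \<in> maximal_extensions E D U"
  show "S \<in> maximal_extensions E (insert v D) (U - {v} - {}) \<or>
     S \<in> maximal_extensions E (insert x D) (U - {x} - {v}) \<or>
     S \<in> maximal_extensions E (insert y D) (U - {y} - {v, x}) \<or>
     S \<in> maximal_extensions E (insert z D) (U - {z} - {v, x, y})"
    using maximal_extensions_take[OF S, of v "{}"] maximal_extensions_take[OF S, of x "{v}"]
      maximal_extensions_take[OF S, of y "{v, x}"] maximal_extensions_take[OF S, of z "{v, x, y}"]
      gnb_hit[OF S v(1)] v(2) by auto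
qed (use finD finU in auto)

lemma bound_gnb0:
  assumes "v \<in> N" "gnb v = {}"
  shows "real (card (maximal_extensions E D U)) \<le> P"
proof -
  have "maximal_extensions E D U \<subseteq> maximal_extensions E (insert v D) (U - {v} - {})"
    using gnb_hit[OF _ assms(1)] maximal_extensions_take[of _ E D U v "{}"] assms(2) by auto
  then have "card (maximal_extensions E D U) \<le> card (maximal_extensions E (insert v D) (U - {v} - {}))"
    by (intro card_mono finite_maximal_extensions) (use finD finU in auto)
  moreover have "real (card (maximal_extensions E (insert v D) (U - {v} - {}))) \<le> P / 1.45"
    using take_near_bound[OF assms(1), of "{}" "{}"] by simp
  ultimately show ?thesis using P_pos by simp
qed

text \<open>With \<open>B = 1.8638\<close>, the two branches cost \<open>2 / 1.45^2 < 1\<close> if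
  \<open>x\<close> is in \<open>N\<close>, and \<open>1 / B + 1 / (1.45 * B) < 1\<close>
  otherwise.\<close>

lemma bound_gnb1:
  assumes v: "v \<in> N" "gnb v = {x}"
  shows "real (card (maximal_extensions E D U)) \<le> P"
proof -
  have x: "x \<in> U" "x \<noteq> v" "v \<in> U" using gnb_subset[of v] v N_subset by auto
  have 1: "real (card (maximal_extensions E (insert v D) (U - {v} - {}))) \<le> P / (1.45 * gain x)"
    using take_near_bound[OF v(1), of "{}" "{x}"] v(2) by simp
  have 2: "real (card (maximal_extensions E (insert x D) (U - {x} - {v}))) \<le> P / (w x * 1.45)"
    using take_far_bound[of x "{v}"] x unfolding w_N[OF v(1), symmetric] by simp
  show ?thesis
    using split_gnb1[OF v] 1 2 P_pos w_N[of x] w_not_N[of x] x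
    by (cases "x \<in> N") (simp_all add: gain_def)
qed


lemma bound_gnb2:
  assumes v: "v \<in> N" "gnb v = {x, y}" "x \<noteq> y"
    and two: "\<And>u. u \<in> N \<Longrightarrow> 2 \<le> card (gnb u)"
  shows "real (card (maximal_extensions E D U)) \<le> P"
proof -
  have xy: "x \<in> U" "x \<noteq> v" "y \<in> U" "y \<noteq> v" "v \<in> U" using gnb_subset[of v] v N_subset by auto
  have v1: "real (card (maximal_extensions E (insert v D) (U - {v} - {}))) \<le> P / (1.45 * (gain x * gain y))"
    using take_near_bound[OF v(1), of "{}" "{x, y}"] v(2,3) by simp
  have far1: "real (card (maximal_extensions E (insert p D) (U - {p} - {v}))) \<le> P / (w p * 1.45)"
    if "p \<in> {x, y}" for p
    using take_far_bound[of p "{v}"] that xy unfolding w_N[OF v(1), symmetric] by auto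
  have far2: "real (card (maximal_extensions E (insert q D) (U - {q} - {v, p}))) \<le> P / (w q * (1.45 * w p))"
    if "{p, q} = {x, y}" for p q
  proof -
    have "q \<in> U" "{v, p} \<subseteq> U - {q}" "p \<noteq> v" using that xy v(3) by (auto simp: doubleton_eq_iff)
    then show ?thesis using take_far_bound[of q "{v, p}"] unfolding w_N[OF v(1), symmetric] by simp
  qed
  \<comment> \<open>The order affects only the first branch omitting \<open>v\<close>, which should
    take the vertex of larger weight. The swapped order serves the case where only \<open>x\<close>
    is in \<open>N\<close>.\<close>
  have v': "gnb v = {y, x}" using v(2) by auto
  note yx = far2[of y x, OF insert_commute] and xy2 = far2[of x y, OF refl]
  consider "x \<notin> N" "y \<notin> N" | "x \<in> N" "y \<notin> N" | "x \<notin> N" "y \<in> N" | "x \<in> N" "y \<in> N" by blast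
  then show ?thesis
  proof cases
    case 1
    then show ?thesis
      using split_gnb2[OF v(1,2)] v1 far1[of x] xy2 P_pos w_not_N[of x] w_not_N[of y] xy
      by (simp add: gain_def)
  next
    case 2
    then show ?thesis
      using split_gnb2[OF v(1) v'] v1 far1[of y] yx P_pos w_N[of x] w_not_N[of y] xy
      by (simp add: gain_def)
  next
    case 3
    then show ?thesis
      using split_gnb2[OF v(1,2)] v1 far1[of x] xy2 P_pos w_not_N[of x] w_N[of y] xy
      by (simp add: gain_def)
  next
    case 4
    show ?thesis
    \<comment> \<open>Without gains in the later branches the cost would be
      \<open>1 / 1.45^2 + 2 / 1.45^3 > 1\<close>. Taking \<open>x\<close> must therefore also lower
      the weight of \<open>y\<close> or of some further vertex.\<close>
    proof (cases "y \<in> gnb x")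
      case True
      have "real (card (maximal_extensions E (insert x D) (U - {x} - {v}))) \<le> P / (1.45 * 1.45 * gain y)"
        using take_near_bound[OF 4(1), of "{v}" "{y}"] w_N[OF v(1)] True xy by simp
      then show ?thesis
        using split_gnb2[OF v(1,2)] v1 xy2 P_pos w_N[of x] w_N[of y] 4
        by (simp add: gain_def)
    next
      case False
      \<comment> \<open>The set \<open>gnb p\<close> has at least two elements, so one of them is
        not \<open>v\<close>; it is not \<open>q\<close> either, since \<open>q\<close> is outside
        \<open>gnb p\<close>. Its gain is at least \<open>1.8638 / 1.45\<close>, which suffices in
        both remaining branches.\<close>
      have other: "\<exists>z\<in>gnb p. z \<noteq> v \<and> z \<noteq> q" if "p \<in> N" "q \<notin> gnb p" for p q
      proof (rule ccontr)
        assume "\<not> ?thesis"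
        then have "gnb p \<subseteq> {v}" using that by auto
        then have "card (gnb p) \<le> 1" using card_mono[of "{v}" "gnb p"] by simp
        then show False using two[OF that(1)] by linarith
      qed
      obtain z where z: "z \<in> gnb x" "z \<noteq> v" "z \<noteq> y" using other[OF 4(1) False] by blast
      obtain z' where z': "z' \<in> gnb y" "z' \<noteq> v" "z' \<noteq> x"
        using other[OF 4(2), of x] False gnb_sym[OF 4] by blast
      have p: "P / (k * gain u) \<le> P / (k * (1.8638 / 1.45))" if "k > 0" for k u
        using that P_pos gain_ge[of u] gain_pos[of u]
        by (intro divide_left_mono mult_left_mono mult_pos_pos) auto
      have "real (card (maximal_extensions E (insert x D) (U - {x} - {v}))) \<le> P / (1.45 * 1.45 * gain z)"
        using take_near_bound[OF 4(1), of "{v}" "{z}"] w_N[OF v(1)] z xy by simp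
      moreover have "real (card (maximal_extensions E (insert y D) (U - {y} - {v, x})))
          \<le> P / (1.45 * (1.45 * 1.45) * gain z')"
        using take_near_bound[OF 4(2), of "{v, x}" "{z'}"] w_N[OF v(1)] w_N[OF 4(1)] z' xy v(3) by simp
      ultimately show ?thesis
        using split_gnb2[OF v(1,2)] v1 P_pos 4 p[of "1.45 * 1.45" z] p[of "1.45 * (1.45 * 1.45)" z']
        by (simp add: gain_def)
    qed
  qed
qed

text \<open>Dropping \<open>v\<close> costs \<open>1 / 1.45\<close>, which leaves
  \<open>0.45 / 1.45\<close> for taking it; hence the threshold \<open>1 / 0.45\<close> for the
  gains.\<close>

lemma bound_gnb_many:
  assumes v: "v \<in> N" and A: "A \<subseteq> gnb v" and g: "1 / 0.45 \<le> (\<Prod>x\<in>A. gain x)"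
  shows "real (card (maximal_extensions E D U)) \<le> P"
proof -
  have "real (card (maximal_extensions E (insert v D) (U - {v} - {}))) \<le> P / (1.45 * (\<Prod>x\<in>A. gain x))"
    using take_near_bound[OF v(1), of "{}" A] A by simp
  also have "\<dots> \<le> P / (1.45 * (1 / 0.45))"
    using P_pos g by (intro divide_left_mono mult_left_mono mult_pos_pos) auto
  finally have "real (card (maximal_extensions E (insert v D) (U - {v} - {}))) \<le> P * (0.45 / 1.45)" by simp
  moreover have "real (card (maximal_extensions E D (U - {v}))) \<le> P / 1.45"
    using drop_bound[of "{v}"] v N_subset w_N[OF v] by auto
  ultimately show ?thesis using split_vertex[of v] by simp
qed

lemma prod_gain_ge:
  assumes "finite A"
  shows "(1.8638 / 1.45) ^ card A \<le> (\<Prod>x\<in>A. gain x)"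
proof -
  have "(\<Prod>x\<in>A. 1.8638 / 1.45) \<le> (\<Prod>x\<in>A. gain x)"
    using gain_ge by (intro prod_mono) simp
  then show ?thesis by simp
qed

text \<open>A vertex with at most one generalized neighbour is preferred for branching. If there is
  none, every vertex of \<open>N\<close> has at least two, as \<open>bound_gnb2\<close>
  requires.\<close>

lemma near_case:
  assumes "N \<noteq> {}"
  shows "real (card (maximal_extensions E D U)) \<le> P"
proof (cases "\<exists>v\<in>N. card (gnb v) \<le> 1")
  case True
  then obtain v where v: "v \<in> N" "card (gnb v) \<le> 1" by blast
  have "finite (gnb v)" using gnb_subset finU by (meson finite_Diff finite_subset)
  then consider "gnb v = {}" | x where "gnb v = {x}"
    using v(2) by (metis card_0_eq card_1_singletonE le_neq_implies_less less_one)
  then show ?thesis using bound_gnb0 bound_gnb1 v(1) by cases auto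
next
  case False
  then have two: "2 \<le> card (gnb v)" if "v \<in> N" for v using that by fastforce
  obtain v where v: "v \<in> N" using assms by blast
  have fin: "finite (gnb v)" using gnb_subset finU by (meson finite_Diff finite_subset)
  \<comment> \<open>Three gains of \<open>1.8638 / 1.45\<close> multiply to about 2.12, short of
    \<open>1 / 0.45\<close>. Three generalized neighbours thus pass the simple take-or-drop rule
    only if one is in \<open>N\<close>; otherwise a four-way branching is used.\<close>
  consider "card (gnb v) = 2" | "3 \<le> card (gnb v)" "gnb v \<inter> N \<noteq> {}"
    | "card (gnb v) = 3" "gnb v \<inter> N = {}" | "4 \<le> card (gnb v)" using two[OF v] by linarith
  then show ?thesis
  proof cases
    case 1
    then obtain x y where "gnb v = {x, y}" "x \<noteq> y" by (auto simp: card_2_iff)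
    then show ?thesis using bound_gnb2[OF v] two by blast
  next
    case 2
    then obtain x where x: "x \<in> gnb v" "x \<in> N" by blast
    have "2 \<le> card (gnb v - {x})" using 2 x by simp
    then obtain A where A: "A \<subseteq> gnb v - {x}" "card A = 2" "finite A"
      by (meson obtain_subset_with_card_n)
    have "(1.8638 / 1.45) ^ 2 * 1.45 \<le> (\<Prod>x\<in>insert x A. gain x)"
      using prod_gain_ge[OF A(3)] A x by (subst prod.insert) (auto simp: gain_def)
    then have "1 / 0.45 \<le> (\<Prod>x\<in>insert x A. gain x)"
      by (rule order_trans[rotated]) (simp add: power2_eq_square)
    then show ?thesis using bound_gnb_many[OF v, of "insert x A"] A x by auto
  next
    case 3
    then obtain x y z where xyz: "gnb v = {x, y, z}" "x \<noteq> y" "x \<noteq> z" "y \<noteq> z"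
      by (auto simp: card_3_iff)
    have U: "x \<in> U" "y \<in> U" "z \<in> U" "v \<in> U" "x \<noteq> v" "y \<noteq> v" "z \<noteq> v" "x \<notin> N" "y \<notin> N" "z \<notin> N"
      using xyz gnb_subset[of v] v N_subset 3 by auto
    \<comment> \<open>The tight case, which dictates the constants: \<open>1.45\<^sup>2/B\<^sup>3 + (1/B + 1/B\<^sup>2 + 1/B\<^sup>3)/1.45 \<le> 1\<close>
      for \<open>B = 1.8638\<close>.\<close>
    note w = w_not_N[OF U(1,8)] w_not_N[OF U(2,9)] w_not_N[OF U(3,10)] w_N[OF v]
    have "real (card (maximal_extensions E (insert v D) (U - {v} - {})))
        \<le> P / (1.45 * ((1.8638 / 1.45) * ((1.8638 / 1.45) * (1.8638 / 1.45))))"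
      using take_near_bound[OF v(1), of "{}" "{x, y, z}"] xyz U by (simp add: gain_def)
    moreover have "real (card (maximal_extensions E (insert x D) (U - {x} - {v}))) \<le> P / (1.8638 * 1.45)"
      using take_far_bound[of x "{v}"] U w by simp
    moreover have "real (card (maximal_extensions E (insert y D) (U - {y} - {v, x})))
        \<le> P / (1.8638 * (1.45 * 1.8638))"
      using take_far_bound[of y "{v, x}"] U w xyz by simp
    moreover have "real (card (maximal_extensions E (insert z D) (U - {z} - {v, x, y})))
        \<le> P / (1.8638 * (1.45 * (1.8638 * 1.8638)))"
      using take_far_bound[of z "{v, x, y}"] U w xyz by simp
    ultimately show ?thesis using split_gnb3[OF v xyz(1)] P_pos by simp
  next
    case 4
    then obtain A where A: "A \<subseteq> gnb v" "card A = 4" "finite A"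
      by (meson obtain_subset_with_card_n)
    have "1 / 0.45 \<le> (\<Prod>x\<in>A. gain x)"
      using prod_gain_ge[OF A(3)] A(2) by (intro order_trans[OF _ prod_gain_ge[OF A(3)]]) (simp add: power_divide)
    then show ?thesis using bound_gnb_many[OF v] A by blast
  qed
qed

end

section \<open>The weight bound for all instances\<close>

text \<open>Induction on the number of undecided vertices. Once cycle-closing vertices are gone,
  \<open>near_case\<close> applies if \<open>T\<close> has an undecided neighbour; otherwise a new
  connected part is started at a vertex of \<open>D\<close> or at an undecided vertex.\<close>

lemma card_maximal_extensions_le_weight:
  assumes "finite D" "finite U" "D \<inter> U = {}" "T \<subseteq> D"
    and "\<And>x y. x \<in> T \<Longrightarrow> y \<in> T \<Longrightarrow> conn E D x y"
  shows "real (card (maximal_extensions E D U)) \<le> (\<Prod>x\<in>U. wt E D T x)"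
  using assms
proof (induction "card U" arbitrary: D T U rule: less_induct)
  case less
  note prems = less.prems
  show ?case
  proof (cases "\<forall>x\<in>U. induces_forest E (insert x D)")
    case False
    then obtain x where x: "x \<in> U" "\<not> induces_forest E (insert x D)" by blast
    have "maximal_extensions E D U \<subseteq> maximal_extensions E D (U - {x})"
    proof
      fix S assume S: "S \<in> maximal_extensions E D U"
      then have "x \<notin> S"
        using x(2) induces_forest_mono[of E S "insert x D"] by (auto simp: maximal_extensions_def)
      then show "S \<in> maximal_extensions E D (U - {x})"
        by (intro maximal_extensions_drop[OF S]) auto
    qed
    then have "card (maximal_extensions E D U) \<le> card (maximal_extensions E D (U - {x}))"
      using prems by (intro card_mono finite_maximal_extensions) auto
    also have "real \<dots> \<le> (\<Prod>x\<in>U - {x}. wt E D T x)"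
      using prems x by (intro less.hyps psubset_card_mono) auto
    also have "\<dots> = (\<Prod>x\<in>U. wt E D T x)"
      using x prems(2) by (subst prod.remove[of U x]) (auto simp: wt_def)
    finally show ?thesis by simp
  next
    case True
    have br: "branching E D T' U"
      if "T' \<subseteq> D" "\<And>x y. x \<in> T' \<Longrightarrow> y \<in> T' \<Longrightarrow> conn E D x y" for T'
      using prems(1-3) True that by unfold_locales (auto intro: less.hyps)
    interpret branching E D T U using br prems by blast
    consider "U = {}" | "N \<noteq> {}" | "U \<noteq> {}" "N = {}" by blast
    then show ?thesis
    proof cases
      case 1
      then have "maximal_extensions E D U \<subseteq> {D}" by (auto simp: maximal_extensions_def)
      then have "card (maximal_extensions E D U) \<le> 1"
        using card_mono[of "{D}" "maximal_extensions E D U"] by simp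
      then show ?thesis using 1 by simp
    next
      case 2
      then show ?thesis by (rule near_case)
    next
      case 3
      have w: "w x = 1.8638" if "x \<in> U" for x using w_not_N that 3 by auto
      then have P: "P = (\<Prod>x\<in>U. 1.8638)" by (intro prod.cong) auto
      show ?thesis
      proof (cases "\<exists>f\<in>D. \<exists>x\<in>U. {x, f} \<in> E")
        case True
        then obtain f x where f: "f \<in> D" "x \<in> U" "{x, f} \<in> E" by blast
        \<comment> \<open>With \<open>N\<close> empty all weights are already the maximal 1.8638, so
          exchanging \<open>T\<close> for \<open>{f}\<close> cannot increase the product.\<close>
        interpret f: branching E D "{f}" U by (rule br) (use f in auto)
        have "real (card (maximal_extensions E D U)) \<le> (\<Prod>x\<in>U. wt E D {f} x)"
          using f by (intro f.near_case) (auto simp: f.N_def)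
        also have "\<dots> \<le> P" unfolding P by (intro prod_mono conjI wt_le wt_pos[THEN less_imp_le])
        finally show ?thesis .
      next
        case noedge: False
        obtain v where v: "v \<in> U" using 3 by blast
        \<comment> \<open>The old part must be contained in the new one, so it is reset to the empty
          set before \<open>{v}\<close> becomes the new part. A neighbour \<open>u\<close> of
          \<open>v\<close> then drops to 1.45, and \<open>1.45 / B^2 + 1 / B < 1\<close> for
          \<open>B = 1.8638\<close>.\<close>
        interpret e: branching E D "{}" U by (rule br) auto
        have we: "wt E D {} x = 1.8638" if "x \<in> U" for x
          using that reduced by (simp add: wt_def)
        then have Pe: "e.P = P" unfolding P by (intro prod.cong) auto
        show ?thesis
        proof (cases "\<exists>u\<in>U - {v}. {u, v} \<in> E")
          case True
          then obtain u where u: "u \<in> U" "u \<noteq> v" "{u, v} \<in> E" by blast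
          have "real (card (maximal_extensions E (insert v D) (U - {v} - {})))
              \<le> e.P / (wt E D {} v * (\<Prod>x\<in>{}. wt E D {} x) * (\<Prod>x\<in>{u}. 1.8638 / 1.45))"
          proof (rule e.take_bound[where T' = "{v}"])
            have "wt E (insert v D) {v} u \<le> 1.45" using u by (simp add: wt_def)
            then show "\<And>x. x \<in> {u} \<Longrightarrow> wt E (insert v D) {v} x * (1.8638 / 1.45) \<le> wt E D {} x"
              using we[OF u(1)] by simp
          qed (use u v in auto)
          moreover have "real (card (maximal_extensions E D (U - {v}))) \<le> P / 1.8638"
            using drop_bound[of "{v}"] v w[OF v] by simp
          ultimately show ?thesis using split_vertex[of v] Pe we[OF v] P_pos by simp
        next
          case False
          have "maximal_extensions E D U \<subseteq> maximal_extensions E (insert v D) (U - {v} - {})"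
          proof
            fix S assume S: "S \<in> maximal_extensions E D U"
            \<comment> \<open>A vertex without neighbours among the decided and undecided ones
              closes no cycle, so maximality forces it in.\<close>
            have "v \<in> S"
            proof (rule ccontr)
              assume vS: "v \<notin> S"
              have "{v, x} \<notin> E" if "x \<in> S" for x
              proof -
                have "x \<in> D \<or> x \<in> U - {v}" using that S vS by (auto simp: maximal_extensions_def)
                then show ?thesis using noedge False v by (metis insert_commute)
              qed
              moreover have "induces_forest E S" using S by (simp add: maximal_extensions_def)
              ultimately have "induces_forest E (insert v S)"
                by (simp add: induces_forest_insert[OF vS])
              then show False using S v vS by (simp add: maximal_extensions_def)
            qed
            then show "S \<in> maximal_extensions E (insert v D) (U - {v} - {})"
              by (intro maximal_extensions_take[OF S]) auto
          qed
          then have "card (maximal_extensions E D U)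
              \<le> card (maximal_extensions E (insert v D) (U - {v} - {}))"
            using prems by (intro card_mono finite_maximal_extensions) auto
          also have "real \<dots> \<le> P / 1.8638" using take_far_bound[of v "{}"] v w[OF v] by simp
          also have "\<dots> \<le> P" using P_pos by simp
          finally show ?thesis by simp
        qed
      qed
    qed
  qed
qed

lemma card_maximal_induced_forests_le:
  assumes "finite V"
  shows "real (card (maximal_induced_forests V E)) \<le> 1.8638 ^ card V"
proof -
  have "real (card (maximal_induced_forests V E)) \<le> (\<Prod>x\<in>V. wt E {} {} x)"
    unfolding maximal_induced_forests_eq_extensions
    using assms by (intro card_maximal_extensions_le_weight) auto
  also have "\<dots> \<le> (\<Prod>x\<in>V. 1.8638)" by (intro prod_mono conjI wt_le wt_pos[THEN less_imp_le])
  finally show ?thesis by simp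
qed

lemma F_le: "real (F N) \<le> 1.8638 ^ N"
proof -
  obtain V :: "nat set" and E where "simple_graph V E" "card V = N"
    "card (maximal_induced_forests V E) = F N" by (rule F_attained)
  then show ?thesis
    using card_maximal_induced_forests_le[of V E] by (auto simp: simple_graph_def)
qed

section \<open>Contraction of forest components\<close>

lemma maximal_subsets_image:
  assumes inj: "inj_on f V" and P: "\<And>S. S \<subseteq> V \<Longrightarrow> P S \<longleftrightarrow> Q (f ` S)" and fin: "finite V"
  shows "card (maximal_subsets V P) \<le> card (maximal_subsets (f ` V) Q)"
proof (rule card_inj_on_le[where f = "(`) f"])
  show "inj_on ((`) f) (maximal_subsets V P)"
    by (rule inj_on_subset[OF inj_on_image_Pow[OF inj]]) (auto simp: maximal_subsets_def)
  show "(`) f ` maximal_subsets V P \<subseteq> maximal_subsets (f ` V) Q"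
  proof (rule image_subsetI)
    fix S assume S: "S \<in> maximal_subsets V P"
    have "\<not> Q T" if T: "f ` S \<subset> T" "T \<subseteq> f ` V" for T
    proof -
      obtain R where R: "R \<subseteq> V" "T = f ` R" using T(2) by (auto simp: subset_image_iff)
      have "S \<subseteq> V" using S by (simp add: maximal_subsets_def)
      then have "x \<in> R" if "x \<in> S" for x
        using that psubset_imp_subset[OF T(1)] R inj_on_image_mem_iff[OF inj, of x R] by blast
      then have "S \<subset> R" using T(1) R by auto
      then show ?thesis using S R P[of R] by (auto simp: maximal_subsets_def)
    qed
    then show "f ` S \<in> maximal_subsets (f ` V) Q"
      using S P[of S] by (auto simp: maximal_subsets_def)
  qed
  show "finite (maximal_subsets (f ` V) Q)"
    by (rule finite_subset[of _ "Pow (f ` V)"]) (use fin in \<open>auto simp: maximal_subsets_def\<close>)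
qed

text \<open>The points of \<open>Z\<close> do not affect \<open>P\<close>, so a maximal set stays
  maximal when all of \<open>Z\<close> is added. Applied to isolated vertices this gives the
  monotonicity of \<open>F\<close> and \<open>M0\<close>.\<close>

lemma maximal_subsets_pad:
  assumes fin: "finite V" "finite Z" and disj: "V \<inter> Z = {}"
    and P: "\<And>S. S \<subseteq> V \<union> Z \<Longrightarrow> P S \<longleftrightarrow> P (S \<inter> V)"
  shows "card (maximal_subsets V P) \<le> card (maximal_subsets (V \<union> Z) P)"
proof (rule card_inj_on_le[where f = "\<lambda>S. S \<union> Z"])
  show "inj_on (\<lambda>S. S \<union> Z) (maximal_subsets V P)"
    by (rule inj_on_inverseI[where g = "\<lambda>S. S \<inter> V"]) (use disj in \<open>auto simp: maximal_subsets_def\<close>)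
  show "(\<lambda>S. S \<union> Z) ` maximal_subsets V P \<subseteq> maximal_subsets (V \<union> Z) P"
  proof (rule image_subsetI)
    fix S assume S: "S \<in> maximal_subsets V P"
    have SV: "S \<subseteq> V" using S by (auto simp: maximal_subsets_def)
    have "\<not> P T" if T: "S \<union> Z \<subset> T" "T \<subseteq> V \<union> Z" for T
    proof -
      have "S \<subset> T \<inter> V" using T SV by auto
      then show ?thesis using S P[OF T(2)] by (auto simp: maximal_subsets_def)
    qed
    moreover have "(S \<union> Z) \<inter> V = S" using SV disj by auto
    then have "P (S \<union> Z)" using S P[of "S \<union> Z"] SV by (auto simp: maximal_subsets_def)
    ultimately show "S \<union> Z \<in> maximal_subsets (V \<union> Z) P"
      using SV by (auto simp: maximal_subsets_def)
  qed
  show "finite (maximal_subsets (V \<union> Z) P)"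
    by (rule finite_subset[of _ "Pow (V \<union> Z)"]) (use fin in \<open>auto simp: maximal_subsets_def\<close>)
qed

lemma exists_padding:
  fixes V :: "nat set"
  assumes "finite V" "card V \<le> N"
  obtains Z where "finite Z" "V \<inter> Z = {}" "card (V \<union> Z) = N"
proof -
  have "infinite (- V)" using assms(1) by simp
  then obtain Z where Z: "Z \<subseteq> - V" "finite Z" "card Z = N - card V"
    by (meson infinite_arbitrarily_large)
  moreover from this have "V \<inter> Z = {}" by auto
  ultimately show thesis using that assms by (simp add: card_Un_disjoint)
qed

lemma F_mono:
  assumes "k \<le> N"
  shows "F k \<le> F N"
proof -
  obtain V :: "nat set" and E where V: "simple_graph V E" "card V = k"
    "card (maximal_induced_forests V E) = F k" by (rule F_attained)
  then have fin: "finite V" and E: "E \<subseteq> Pow V" by (auto simp: simple_graph_def nsets_def)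
  obtain Z where Z: "finite Z" "V \<inter> Z = {}" "card (V \<union> Z) = N"
    using exists_padding[OF fin] V(2) assms by blast
  have "induced_edges E S = induced_edges E (S \<inter> V)" for S
    using E by (auto simp: induced_edges_def)
  then have "card (maximal_induced_forests V E) \<le> card (maximal_induced_forests (V \<union> Z) E)"
    unfolding maximal_induced_forests_def by (intro maximal_subsets_pad fin Z) metis
  also have "\<dots> \<le> F (card (V \<union> Z))"
    using V(1) Z by (intro F_ge) (auto simp: simple_graph_def nsets_def)
  finally show ?thesis using V Z by simp
qed

lemma M0_mono:
  assumes "k \<le> N"
  shows "M0 k \<le> M0 N"
proof -
  obtain V :: "nat set" and E where V: "simple_graph V E" "card V = k"
    "card (maximal_independent_sets V E) = M0 k" by (rule M0_attained)
  then have fin: "finite V" and E: "E \<subseteq> Pow V" by (auto simp: simple_graph_def nsets_def)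
  obtain Z where Z: "finite Z" "V \<inter> Z = {}" "card (V \<union> Z) = N"
    using exists_padding[OF fin] V(2) assms by blast
  have "indep S E \<longleftrightarrow> indep (S \<inter> V) E" for S
    using E by (auto simp: indep_def)
  then have "card (maximal_independent_sets V E) \<le> card (maximal_independent_sets (V \<union> Z) E)"
    unfolding maximal_independent_sets_def by (intro maximal_subsets_pad fin Z) metis
  also have "\<dots> \<le> M0 (card (V \<union> Z))"
    using V(1) Z by (intro M0_ge) (auto simp: simple_graph_def nsets_def)
  finally show ?thesis using V Z by simp
qed

lemma M0_pos: "0 < M0 N"
proof -
  have "maximal_independent_sets {} {} = {{} :: nat set}"
    by (auto simp: maximal_independent_sets_def maximal_subsets_def)
  then have "1 \<le> M0 0" using M0_ge[of "{}" "{}"] by (simp add: simple_graph_def)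
  then show ?thesis using M0_mono[of 0 N] by simp
qed

text \<open>\<open>M0\<close> ranges over graphs on natural numbers, so the graph is copied along an
  injection. The copy keeps only edges between distinct vertices, the only ones that
  \<open>indep\<close> sees.\<close>

lemma card_maximal_independent_sets_le_M0:
  assumes fin: "finite W" and "card W \<le> N"
  shows "card (maximal_independent_sets W E) \<le> M0 N"
proof -
  obtain f :: "'a \<Rightarrow> nat" where f: "inj_on f W"
    using fin by (meson finite_imp_inj_to_nat_seg)
  define E' where "E' = {{f x, f y} | x y. x \<in> W \<and> y \<in> W \<and> x \<noteq> y \<and> {x, y} \<in> E}"
  have edge: "{f x, f y} \<in> E' \<longleftrightarrow> {x, y} \<in> E" if "x \<in> W" "y \<in> W" "x \<noteq> y" for x y
    using that f by (auto simp: E'_def doubleton_eq_iff inj_on_eq_iff insert_commute)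
  have "indep S E \<longleftrightarrow> indep (f ` S) E'" if "S \<subseteq> W" for S
  proof -
    have "f x = f y \<longleftrightarrow> x = y" if "x \<in> S" "y \<in> S" for x y
      using f that \<open>S \<subseteq> W\<close> by (meson inj_on_eq_iff subsetD)
    then show ?thesis unfolding indep_def using edge that by (simp add: subset_iff)
  qed
  then have "card (maximal_independent_sets W E) \<le> card (maximal_independent_sets (f ` W) E')"
    unfolding maximal_independent_sets_def by (rule maximal_subsets_image[OF f _ fin])
  also have "\<dots> \<le> M0 (card (f ` W))"
    using fin f by (intro M0_ge) (auto simp: simple_graph_def E'_def nsets_def card_insert_if inj_on_eq_iff)
  also have "\<dots> \<le> M0 N" using assms f by (intro M0_mono) (simp add: card_image)
  finally show ?thesis .
qed

lemma induces_forest_no_edges: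
  assumes "induced_edges E S = {}"
  shows "induces_forest E S"
  using assms by (simp add: induces_forest_def forest_def is_cycle_iff_successively)

text \<open>The map \<open>f\<close> collapses each component of \<open>D\<close> to one vertex. Undecided vertices that close a cycle
  with \<open>D\<close> are discarded first, since contraction would lose their double edges.\<close>

lemma card_maximal_extensions_le_F:
  fixes f :: "'a \<Rightarrow> nat"
  assumes fin: "finite D" "finite U" and disj: "D \<inter> U = {}" and D: "induces_forest E D"
    and inj: "inj_on f U" and fdisj: "f ` D \<inter> f ` U = {}"
    and fib: "\<And>x y. x \<in> D \<Longrightarrow> y \<in> D \<Longrightarrow> f x = f y \<longleftrightarrow> conn E D x y"
    and N: "card (f ` D) + card U \<le> N"
  shows "card (maximal_extensions E D U) \<le> F N"
proof -
  define U' where "U' = {x \<in> U. induces_forest E (insert x D)}"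
  define H where "H = {{f x, f y} | x y. x \<in> D \<union> U' \<and> y \<in> D \<union> U' \<and> {x, y} \<in> E \<and> f x \<noteq> f y}"
  have U'U: "U' \<subseteq> U" by (auto simp: U'_def)
  \<comment> \<open>Only vertices of \<open>D\<close> are ever merged.\<close>
  have fibU: "x = y \<or> x \<in> D \<and> y \<in> D \<and> conn E D x y" if "x \<in> D \<union> U'" "y \<in> D \<union> U'" "f x = f y" for x y
  proof -
    have "x \<in> D \<longleftrightarrow> y \<in> D" using that fdisj U'U by (metis UnE disjoint_iff image_eqI subsetD)
    then show ?thesis using that fib inj U'U by (metis UnE inj_onD subsetD)
  qed
  have mem: "x \<in> D \<union> A" if "A \<subseteq> U'" "x \<in> D \<union> U'" "f x \<in> f ` (D \<union> A)" for x A
    using that fibU[of x] by blast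
  have Hedge: "\<exists>x y. x \<in> D \<union> A \<and> y \<in> D \<union> A \<and> {x, y} \<in> E \<and> f x = p \<and> f y = q"
    if A: "A \<subseteq> U'" and pq: "{p, q} \<in> H" "p \<in> f ` (D \<union> A)" "q \<in> f ` (D \<union> A)" for p q A
  proof -
    obtain x y where xy: "x \<in> D \<union> U'" "y \<in> D \<union> U'" "{x, y} \<in> E" "{p, q} = {f x, f y}"
      using pq(1) by (auto simp: H_def)
    have "x \<in> D \<union> A" "y \<in> D \<union> A" using mem[OF A] xy pq(2,3) by (metis doubleton_eq_iff)+
    then show ?thesis using xy by (metis doubleton_eq_iff insert_commute)
  qed
  have conn1: "conn H (f ` (D \<union> A)) (f x) (f y)"
    if A: "A \<subseteq> U'" and c: "conn E (D \<union> A) x y" for A x y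
    using c[unfolded conn_def]
  proof (induction rule: rtranclp_induct)
    case (step y z)
    have "conn H (f ` (D \<union> A)) (f y) (f z)"
    proof (cases "f y = f z")
      case False
      then show ?thesis using step.hyps A by (intro conn_edge) (auto simp: H_def)
    qed simp
    then show ?case using step.IH by (rule conn_trans[rotated])
  qed simp
  \<comment> \<open>Each fibre of \<open>f\<close> is connected in the original graph, so a walk in
    the contracted graph lifts edge by edge.\<close>
  have conn2: "conn E (D \<union> A) x y"
    if A: "A \<subseteq> U'" and c: "conn H (f ` (D \<union> A)) (f x) (f y)" and x: "x \<in> D \<union> A" "y \<in> D \<union> A" for A x y
  proof -
    have same: "conn E (D \<union> A) u v" if "u \<in> D \<union> A" "v \<in> D \<union> A" "f u = f v" for u v
    proof -
      have "u \<in> D \<union> U'" "v \<in> D \<union> U'" using that A by auto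
      then have "u = v \<or> conn E D u v" using fibU[of u v] that(3) by blast
      then show ?thesis by (auto intro: conn_mono)
    qed
    have "\<forall>y\<in>D \<union> A. f y = q \<longrightarrow> conn E (D \<union> A) x y" if "conn H (f ` (D \<union> A)) (f x) q" for q
      using that[unfolded conn_def]
    proof (induction rule: rtranclp_induct)
      case base
      then show ?case using same x by auto
    next
      case (step p q)
      obtain u v where uv: "u \<in> D \<union> A" "v \<in> D \<union> A" "{u, v} \<in> E" "f u = p" "f v = q"
        using Hedge[OF A, of p q] step.hyps by blast
      have "conn E (D \<union> A) x v" using step.IH uv by (auto intro: conn_trans conn_edge)
      then show ?case using same[of v] uv by (auto intro: conn_trans)
    qed
    then show ?thesis using c x by blast
  qed
  \<comment> \<open>The vertices of \<open>A\<close> are added one at a time, with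
    \<open>induces_forest_insert\<close> on both sides. At the start \<open>D\<close> contracts to a
    set without edges, as no edge joins different components.\<close>
  have forest_iff: "induces_forest E (D \<union> A) \<longleftrightarrow> induces_forest H (f ` (D \<union> A))"
    if "A \<subseteq> U'" for A
  proof -
    have "finite A" using that U'U fin by (meson finite_subset)
    then show ?thesis using that
    proof (induction A rule: finite_induct)
      case empty
      have "induced_edges H (f ` D) = {}"
      proof (rule ccontr)
        assume "\<not> ?thesis"
        then obtain e where e: "e \<in> H" "e \<subseteq> f ` D" by (auto simp: induced_edges_def)
        then obtain x y where xy: "x \<in> D \<union> U'" "y \<in> D \<union> U'" "{x, y} \<in> E" "f x \<noteq> f y"
            "e = {f x, f y}"
          unfolding H_def by blast
        then have "x \<in> D" "y \<in> D" using mem[of "{}" x] mem[of "{}" y] e(2) by auto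
        then show False using fib[of x y] xy by (auto intro: conn_edge)
      qed
      then show ?case using D by (simp add: induces_forest_no_edges)
    next
      case (insert r A)
      then have A: "A \<subseteq> U'" and r: "r \<in> U'" by auto
      have rDA: "r \<notin> D \<union> A" using r insert.hyps U'U disj by auto
      have frDA: "f r \<notin> f ` (D \<union> A)" using mem[OF A, of r] r rDA by blast
      have rD: "r \<notin> D" using rDA by auto
      \<comment> \<open>A vertex of \<open>U'\<close> has at most one neighbour in each component of
        \<open>D\<close>, so contraction merges none of its edges.\<close>
      have one: "x = y" if "x \<in> D" "y \<in> D" "{r, x} \<in> E" "{r, y} \<in> E" "conn E D x y" for x y
        using that r rD by (auto simp: U'_def induces_forest_insert)
      have Hr: "{f r, f x} \<in> H" if "x \<in> D \<union> A" "{r, x} \<in> E" for x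
        using that r A frDA by (auto simp: H_def)
      have Hr': "\<exists>x\<in>D \<union> A. {r, x} \<in> E \<and> f x = q" if q: "{f r, q} \<in> H" "q \<in> f ` (D \<union> A)" for q
      proof -
        obtain x y where xy: "x \<in> D \<union> insert r A" "y \<in> D \<union> insert r A" "{x, y} \<in> E" "f x = f r" "f y = q"
          using Hedge[of "insert r A" "f r" q] insert.prems q by auto
        have "x = r" using fibU[of x r] xy insert.prems r rD by auto
        moreover have "y \<noteq> r" using xy q frDA by auto
        ultimately show ?thesis using xy by auto
      qed
      have "(\<forall>x\<in>D \<union> A. \<forall>y\<in>D \<union> A. {r, x} \<in> E \<longrightarrow> {r, y} \<in> E \<longrightarrow> conn E (D \<union> A) x y \<longrightarrow> x = y) \<longleftrightarrow>
        (\<forall>p\<in>f ` (D \<union> A). \<forall>q\<in>f ` (D \<union> A). {f r, p} \<in> H \<longrightarrow> {f r, q} \<in> H \<longrightarrow>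
           conn H (f ` (D \<union> A)) p q \<longrightarrow> p = q)" (is "?L \<longleftrightarrow> ?R")
      proof
        assume L: ?L
        show ?R
        proof (intro ballI impI)
          fix p q assume pq: "p \<in> f ` (D \<union> A)" "q \<in> f ` (D \<union> A)" "{f r, p} \<in> H" "{f r, q} \<in> H"
            "conn H (f ` (D \<union> A)) p q"
          obtain x y where "x \<in> D \<union> A" "{r, x} \<in> E" "f x = p" "y \<in> D \<union> A" "{r, y} \<in> E" "f y = q"
            using Hr'[of p] Hr'[of q] pq by blast
          then show "p = q" using L conn2[OF A, of x y] pq by blast
        qed
      next
        assume R: ?R
        show ?L
        proof (intro ballI impI)
          fix x y assume xy: "x \<in> D \<union> A" "y \<in> D \<union> A" "{r, x} \<in> E" "{r, y} \<in> E" "conn E (D \<union> A) x y"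
          then have "f x = f y" using R Hr conn1[OF A] by blast
          then have "x = y \<or> x \<in> D \<and> y \<in> D \<and> conn E D x y" using fibU xy A by blast
          then show "x = y" using one xy by blast
        qed
      qed
      then have "induces_forest E (insert r (D \<union> A)) \<longleftrightarrow> induces_forest H (insert (f r) (f ` (D \<union> A)))"
        unfolding induces_forest_insert[OF rDA] induces_forest_insert[OF frDA]
        using insert.IH[OF A] by blast
      then show ?case by simp
    qed
  qed
  have sub: "S \<subseteq> D \<union> U'" if S: "S \<in> maximal_extensions E D U" for S
  proof
    fix x assume x: "x \<in> S"
    have "insert x D \<subseteq> S" using S x by (auto simp: maximal_extensions_def)
    then have "induces_forest E (insert x D)"
      using S induces_forest_mono[of E S] by (auto simp: maximal_extensions_def)
    then show "x \<in> D \<union> U'" using S x by (auto simp: maximal_extensions_def U'_def)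
  qed
  have dec: "S = D \<union> (S - D)" "S - D \<subseteq> U'" if "D \<subseteq> S" "S \<subseteq> D \<union> U'" for S using that by auto
  have iff: "induces_forest E S \<longleftrightarrow> induces_forest H (f ` S)" if "D \<subseteq> S" "S \<subseteq> D \<union> U'" for S
    using forest_iff[of "S - D"] dec[OF that] by metis
  have inS: "x \<in> S" if "f x \<in> f ` S" "x \<in> D \<union> U'" "D \<subseteq> S" "S \<subseteq> D \<union> U'" for x S
    using mem[of "S - D" x] dec[OF that(3,4)] that by auto
  \<comment> \<open>The map taking \<open>S\<close> to its image is injective, because every
    extension contains \<open>D\<close> and \<open>f\<close> separates the other vertices. The
    images contain the contracted \<open>D\<close>, so they are maximal forests without any
    prescribed part.\<close>
  have "card (maximal_extensions E D U) \<le> card (maximal_extensions H {} (f ` (D \<union> U')))"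
  proof (rule card_inj_on_le[where f = "(`) f"])
    show "inj_on ((`) f) (maximal_extensions E D U)"
    proof (rule inj_onI)
      fix S R assume SR: "S \<in> maximal_extensions E D U" "R \<in> maximal_extensions E D U" "f ` S = f ` R"
      have "X \<subseteq> Y" if "X \<in> maximal_extensions E D U" "Y \<in> maximal_extensions E D U" "f ` X = f ` Y" for X Y
      proof
        fix x assume x: "x \<in> X"
        have "D \<subseteq> Y" using that(2) by (simp add: maximal_extensions_def)
        moreover have "f x \<in> f ` Y" using x that(3) by blast
        ultimately show "x \<in> Y" using inS[of x Y] x sub[OF that(1)] sub[OF that(2)] by blast
      qed
      then show "S = R" using SR by (metis subset_antisym)
    qed
    show "(`) f ` maximal_extensions E D U \<subseteq> maximal_extensions H {} (f ` (D \<union> U'))"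
    proof (rule image_subsetI)
      fix S assume S: "S \<in> maximal_extensions E D U"
      note SU = sub[OF S]
      have DS: "D \<subseteq> S" "induces_forest E S" using S by (auto simp: maximal_extensions_def)
      have "\<not> induces_forest H (insert q (f ` S))" if q: "q \<in> f ` (D \<union> U') - f ` S" for q
      proof -
        obtain x where x: "x \<in> D \<union> U'" "q = f x" "x \<notin> S" using q by auto
        then have "\<not> induces_forest E (insert x S)"
          using S DS U'U by (auto simp: maximal_extensions_def)
        then show ?thesis using iff[of "insert x S"] x DS SU by auto
      qed
      then show "f ` S \<in> maximal_extensions H {} (f ` (D \<union> U'))"
        using iff[OF DS(1) SU] DS SU by (auto simp: maximal_extensions_def)
    qed
    show "finite (maximal_extensions H {} (f ` (D \<union> U')))"
      using fin U'U by (intro finite_maximal_extensions) (auto intro: finite_subset)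
  qed
  also have "\<dots> \<le> F (card (f ` (D \<union> U')))"
    unfolding maximal_induced_forests_eq_extensions[symmetric]
    using fin U'U by (intro F_ge)
      (auto simp: simple_graph_def H_def nsets_def card_insert_if intro: finite_subset)
  also have "\<dots> \<le> F N"
  proof (rule F_mono)
    have "card (f ` (D \<union> U')) \<le> card (f ` D) + card (f ` U')"
      by (metis card_Un_le image_Un)
    also have "card (f ` U') \<le> card U'" using fin U'U by (intro card_image_le) (auto intro: finite_subset)
    also have "card U' \<le> card U" using fin U'U by (intro card_mono)
    finally show "card (f ` (D \<union> U')) \<le> N" using N by simp
  qed
  finally show ?thesis .
qed

section \<open>Complements of closed graphs\<close>

text \<open>For an edge \<open>uv\<close> in the complement of a \<open>c\<close>-closed graph this
  set has at most \<open>c - 1\<close> elements; closedness enters the counting only in this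
  form.\<close>

definition non_neighbors :: "'a set \<Rightarrow> 'a set set \<Rightarrow> 'a \<Rightarrow> 'a \<Rightarrow> 'a set" where
  "non_neighbors V E u v = {w \<in> V - {u, v}. {u, w} \<notin> E \<and> {v, w} \<notin> E}"

section \<open>Maximal independent sets in complements of closed graphs\<close>

text \<open>Insert \<open>v\<close> into \<open>Y\<close>. A set that does not stay maximal in
  \<open>Y\<close> after losing \<open>v\<close> contains \<open>v\<close>, and without
  \<open>v\<close> it is maximal independent among the common non-neighbours of \<open>v\<close> and
  some neighbour \<open>w\<close>. Each insertion thus adds at most \<open>card Y * M0 k\<close>
  sets.\<close>

lemma card_maximal_independent_sets_le:
  assumes finV: "finite V" and "X \<subseteq> V"
    and closed: "\<And>u v. u \<in> V \<Longrightarrow> v \<in> V \<Longrightarrow> {u, v} \<in> E \<Longrightarrow> card (non_neighbors V E u v) \<le> k"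
  shows "card (maximal_independent_sets X E) \<le> (1 + (card X)\<^sup>2) * M0 k"
proof -
  have "finite X" using assms finite_subset by blast
  then show ?thesis using \<open>X \<subseteq> V\<close>
  proof (induction X rule: finite_induct)
    case empty
    have "maximal_independent_sets {} E = {{}}"
      by (auto simp: maximal_independent_sets_def maximal_subsets_def)
    then show ?case using M0_pos[of k] by simp
  next
    case (insert v Y)
    let ?X = "insert v Y"
    let ?M = "\<lambda>X. maximal_independent_sets X E"
    have fin: "finite (?M A)" if "finite A" for A
      using that by (intro finite_subset[of "?M A" "Pow A"])
        (auto simp: maximal_independent_sets_def maximal_subsets_def)
    define A where "A = {I \<in> ?M ?X. I - {v} \<in> ?M Y}"
    define W where "W w = {z \<in> Y - {w}. {v, z} \<notin> E \<and> {w, z} \<notin> E}" for w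
    define Y' where "Y' = {w \<in> Y. {v, w} \<in> E}"
    have old: "card A \<le> card (?M Y)"
    proof (rule card_inj_on_le[where f = "\<lambda>I. I - {v}"])
      \<comment> \<open>Two sets of \<open>A\<close> that differ only in \<open>v\<close> would be
        nested, against maximality.\<close>
      have *: "v \<in> J" if "I \<in> A" "J \<in> A" "I - {v} = J - {v}" "v \<in> I" for I J
      proof (rule ccontr)
        assume "v \<notin> J"
        then have "J \<subset> I" using that by auto
        moreover have "I \<subseteq> ?X" "indep I E"
          using that(1) by (simp_all add: A_def maximal_independent_sets_def maximal_subsets_def)
        moreover have "J \<in> ?M ?X" using that(2) by (simp add: A_def)
        ultimately show False
          unfolding maximal_independent_sets_def maximal_subsets_def by blast
      qed
      show "inj_on (\<lambda>I. I - {v}) A"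
      proof (rule inj_onI)
        fix I J assume "I \<in> A" "J \<in> A" "I - {v} = J - {v}"
        then show "I = J" using *[of I J] *[of J I] by blast
      qed
    qed (use fin insert in \<open>auto simp: A_def\<close>)
    have "?M ?X - A \<subseteq> (\<Union>w\<in>Y'. insert v ` ?M (W w))"
    proof
      fix I assume I: "I \<in> ?M ?X - A"
      have IX: "I \<subseteq> ?X" "indep I E" and Imax: "\<And>T. I \<subset> T \<Longrightarrow> T \<subseteq> ?X \<Longrightarrow> \<not> indep T E"
        using I by (auto simp: maximal_independent_sets_def maximal_subsets_def)
      have nI: "I - {v} \<notin> ?M Y" using I by (auto simp: A_def)
      have "indep (I - {v}) E" using IX(2) by (rule smaller_indep) auto
      then obtain T where T: "I - {v} \<subset> T" "T \<subseteq> Y" "indep T E"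
        using nI IX(1) by (auto simp: maximal_independent_sets_def maximal_subsets_def)
      have "v \<in> I"
      proof (rule ccontr)
        assume "v \<notin> I"
        then have "I \<subset> T" using T(1) by auto
        then show False using Imax[of T] T by auto
      qed
      obtain w where w: "w \<in> T" "w \<notin> I" "w \<in> Y" "w \<noteq> v" using T insert.hyps by blast
      have wI: "{w, x} \<notin> E" if "x \<in> I - {v}" for x
      proof -
        have "x \<in> T" "x \<noteq> w" using that w(2) T(1) by auto
        then show ?thesis using w(1) T(3) by (auto simp: indep_def)
      qed
      have vI: "{v, x} \<notin> E" if "x \<in> I - {v}" for x
        using that IX(2) \<open>v \<in> I\<close> by (auto simp: indep_def)
      \<comment> \<open>The vertex \<open>w\<close> is compatible with everything in
        \<open>I\<close> except possibly \<open>v\<close>, so the conflict must be the edge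
        \<open>vw\<close>.\<close>
      have "\<not> indep (insert w I) E" using w IX by (intro Imax) auto
      then have wv: "{v, w} \<in> E"
        using IX(2) wI by (auto simp: indep_def insert_commute)
      have "I - {v} \<in> ?M (W w)"
      proof -
        have "I - {v} \<subseteq> W w" using IX(1) w wI vI by (auto simp: W_def)
        moreover have "\<not> indep T' E" if T': "I - {v} \<subset> T'" "T' \<subseteq> W w" for T'
        proof
          assume "indep T' E"
          then have "indep (insert v T') E"
            using T'(2) by (auto simp: indep_def W_def insert_commute)
          moreover have "v \<notin> T'" using T'(2) insert.hyps by (auto simp: W_def)
          then have "I \<subset> insert v T'" using T'(1) \<open>v \<in> I\<close> by auto
          ultimately show False using Imax[of "insert v T'"] T'(2) by (auto simp: W_def)
        qed
        ultimately show ?thesis using \<open>indep (I - {v}) E\<close>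
          by (auto simp: maximal_independent_sets_def maximal_subsets_def)
      qed
      moreover have "I = insert v (I - {v})" using \<open>v \<in> I\<close> by auto
      ultimately have "I \<in> insert v ` ?M (W w)" by (metis imageI)
      then show "I \<in> (\<Union>w\<in>Y'. insert v ` ?M (W w))" using w wv by (auto simp: Y'_def)
    qed
    then have "card (?M ?X - A) \<le> card (\<Union>w\<in>Y'. insert v ` ?M (W w))"
      using insert.hyps by (intro card_mono finite_UN_I finite_imageI fin) (auto simp: Y'_def W_def)
    also have "\<dots> \<le> (\<Sum>w\<in>Y'. card (insert v ` ?M (W w)))"
      using insert.hyps by (intro card_UN_le) (auto simp: Y'_def)
    also have "\<dots> \<le> (\<Sum>w\<in>Y'. M0 k)"
    proof (rule sum_mono)
      fix w assume w: "w \<in> Y'"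
      have fW: "finite (W w)" using insert.hyps by (auto simp: W_def)
      have "card (W w) \<le> card (non_neighbors V E v w)"
        using insert.hyps insert.prems finV
        by (intro card_mono) (auto simp: W_def non_neighbors_def)
      also have "\<dots> \<le> k" using w insert.prems by (intro closed) (auto simp: Y'_def)
      finally have "card (?M (W w)) \<le> M0 k"
        by (intro card_maximal_independent_sets_le_M0 fW)
      then show "card (insert v ` ?M (W w)) \<le> M0 k"
        using card_image_le[OF fin[OF fW], of "insert v"] by linarith
    qed
    also have "\<dots> \<le> card Y * M0 k"
      using insert.hyps card_mono[of Y Y'] by (auto simp: Y'_def)
    finally have "card (?M ?X - A) \<le> card Y * M0 k" .
    moreover note old
    moreover have "card (?M ?X) = card A + card (?M ?X - A)"
      using fin[of ?X] insert.hyps by (subst card_Diff_subset) (auto simp: A_def card_mono)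
    moreover have "card (?M Y) \<le> (1 + (card Y)\<^sup>2) * M0 k" using insert by auto
    ultimately have "card (?M ?X) \<le> (1 + (card Y)\<^sup>2 + card Y) * M0 k"
      by (simp add: algebra_simps)
    also have "\<dots> \<le> (1 + (card ?X)\<^sup>2) * M0 k"
      using insert.hyps by (intro mult_right_mono) (auto simp: power2_eq_square)
    finally show ?case .
  qed
qed

section \<open>Stars and pairs of disjoint edges in a forest\<close>

lemma conn_indep: "conn E S x y \<Longrightarrow> indep S E \<Longrightarrow> x = y"
  unfolding conn_def by (induction rule: rtranclp_induct) (auto simp: indep_def)

lemma induces_forest_indep:
  assumes "indep S E"
  shows "induces_forest E S"
proof -
  have False if p: "is_cycle E p" "set p \<subseteq> S" for p
  proof -
    obtain a b q where "p = a # b # q"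
      using p(1) by (cases p rule: remdups_adj.cases) (auto simp: is_cycle_def)
    then show False using p assms by (auto simp: indep_def is_cycle_iff_successively)
  qed
  then show ?thesis by (auto simp: induces_forest_iff)
qed

text \<open>If the independent set could be enlarged by \<open>x\<close>, restoring \<open>v\<close>
  would give a star with isolated vertices, a forest larger than \<open>S\<close>.\<close>

lemma star_maximal_forest:
  assumes S: "S \<in> maximal_extensions E {} V" and v: "v \<in> S" "indep (S - {v}) E"
  shows "S - {v} \<in> maximal_independent_sets (V - {v}) E"
proof -
  have "\<not> indep T E" if T: "S - {v} \<subset> T" "T \<subseteq> V - {v}" for T
  proof
    assume iT: "indep T E"
    obtain x where x: "x \<in> T" "x \<notin> S" using T by auto
    have "indep (insert x (S - {v})) E" using iT by (rule smaller_indep) (use x T in auto)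
    moreover have "v \<notin> insert x (S - {v})" using x v by auto
    ultimately have "induces_forest E (insert v (insert x (S - {v})))"
      by (auto simp: induces_forest_insert induces_forest_indep dest: conn_indep)
    moreover have "insert v (insert x (S - {v})) = insert x S" using v by auto
    ultimately show False using S x T by (auto simp: maximal_extensions_def)
  qed
  then show ?thesis using S v
    by (auto simp: maximal_extensions_def maximal_independent_sets_def maximal_subsets_def)
qed

lemma forest_neighbors_not_conn:
  assumes "induces_forest E S" "z \<in> S" "x \<in> S" "y \<in> S" "x \<noteq> y" "x \<noteq> z" "y \<noteq> z"
    "{z, x} \<in> E" "{z, y} \<in> E"
  shows "\<not> conn E (S - {z}) x y"
proof -
  have "insert z (S - {z}) = S" using assms(2) by auto
  then show ?thesis using assms induces_forest_insert[of z "S - {z}" E] by auto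
qed

text \<open>Pairwise intersecting edges form a star or a triangle, and a forest has no
  triangle.\<close>

lemma star_or_disjoint_edges:
  assumes S: "induces_forest E S" "S \<noteq> {}"
  obtains v where "v \<in> S" "indep (S - {v}) E"
  | a b c d where "distinct [a, b, c, d]" "{a, b, c, d} \<subseteq> S" "{a, b} \<in> E" "{c, d} \<in> E"
proof (cases "\<exists>a b c d. distinct [a, b, c, d] \<and> {a, b, c, d} \<subseteq> S \<and> {a, b} \<in> E \<and> {c, d} \<in> E")
  case True
  then show thesis using that by blast
next
  case False
  then have nd: False if "distinct [a, b, c, d]" "{a, b, c, d} \<subseteq> S" "{a, b} \<in> E" "{c, d} \<in> E"
    for a b c d using that by blast
  have "\<exists>v\<in>S. indep (S - {v}) E"
  proof (cases "indep S E")
    case True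
    then show ?thesis using S(2) smaller_indep[of S E] by blast
  next
    case False
    then obtain a b where ab: "a \<in> S" "b \<in> S" "a \<noteq> b" "{a, b} \<in> E" by (auto simp: indep_def)
    have meets: "\<exists>z\<in>S. z \<noteq> p \<and> z \<noteq> q \<and> {q, z} \<in> E"
      if pq: "{p, q} = {a, b}" "\<not> indep (S - {p}) E" for p q
    proof -
      have pq': "p \<noteq> q" "p \<in> S" "q \<in> S" "{p, q} \<in> E" using pq ab by (auto simp: doubleton_eq_iff insert_commute)
      obtain x y where xy: "x \<in> S" "y \<in> S" "x \<noteq> p" "y \<noteq> p" "x \<noteq> y" "{x, y} \<in> E"
        using pq(2) by (auto simp: indep_def)
      then have "x = q \<or> y = q" using nd[of p q x y] pq' by auto
      then show ?thesis using xy by (auto simp: insert_commute)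
    qed
    show ?thesis
    proof (rule ccontr)
      assume "\<not> ?thesis"
      then have n: "\<not> indep (S - {a}) E" "\<not> indep (S - {b}) E" using ab by auto
      obtain x where x: "x \<in> S" "x \<noteq> a" "x \<noteq> b" "{b, x} \<in> E" using meets[of a b] n by auto
      obtain y where y: "y \<in> S" "y \<noteq> a" "y \<noteq> b" "{a, y} \<in> E" using meets[of b a] n by auto
      have "x = y" using nd[of b x a y] x y ab by auto
      then have "\<not> conn E (S - {x}) a b"
        using forest_neighbors_not_conn[OF S(1), of x a b] x y ab by (auto simp: insert_commute)
      then show False using ab x by (auto intro: conn_edge)
    qed
  qed
  then show thesis using that by blast
qed

text \<open>The edges are chosen anew so that no other vertex of \<open>S\<close> is adjacent to
  both. That \<open>d\<close> misses \<open>ab\<close> limits the choices of \<open>d\<close>;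
  together with \<open>a\<close> missing \<open>cd\<close> it later saves one vertex in each
  non-neighbourhood.\<close>

lemma two_edges_dominate:
  assumes S: "induces_forest E S"
    and abcd: "distinct [a, b, c, d]" "{a, b, c, d} \<subseteq> S" "{a, b} \<in> E" "{c, d} \<in> E"
    and SV: "S \<subseteq> V"
  obtains a b c d where "distinct [a, b, c, d]" "{a, b, c, d} \<subseteq> S" "{a, b} \<in> E" "{c, d} \<in> E"
    "{a, c} \<notin> E" "d \<in> non_neighbors V E a b" "a \<in> non_neighbors V E c d"
    "S \<subseteq> {a, b, c, d} \<union> non_neighbors V E a b \<union> non_neighbors V E c d"
proof -
  define adj where "adj x y \<longleftrightarrow> {x, y} \<in> E" for x y
  have sym: "adj x y \<longleftrightarrow> adj y x" for x y by (simp add: adj_def insert_commute)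
  have tri: "\<not> adj x z" if "distinct [x, y, z]" "{x, y, z} \<subseteq> S" "adj x y" "adj y z" for x y z
    using forest_neighbors_not_conn[OF S, of x y z] that by (auto simp: adj_def intro: conn_edge)
  have nn: "non_neighbors V E u v = {w \<in> V - {u, v}. \<not> adj u w \<and> \<not> adj v w}" for u v
    by (simp add: non_neighbors_def adj_def)
  show thesis
  proof (cases "\<exists>a b c d. distinct [a, b, c, d] \<and> {a, b, c, d} \<subseteq> S \<and> adj a b \<and> adj b c \<and> adj c d")
    case True
    then obtain a b c d where p: "distinct [a, b, c, d]" "{a, b, c, d} \<subseteq> S" "adj a b" "adj b c" "adj c d"
      by blast
    \<comment> \<open>The path survives the removal of \<open>z\<close>, so a vertex
      \<open>z\<close> adjacent to both end edges would close a cycle.\<close>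
    have conn_rest: "conn E (S - {z}) p q" if "z \<notin> {a, b, c, d}" "p \<in> {a, b}" "q \<in> {c, d}" for p q z
    proof -
      have "conn E (S - {z}) a b" "conn E (S - {z}) b c" "conn E (S - {z}) c d"
        using p that by (auto simp: adj_def intro!: conn_edge)
      then show ?thesis using that(2,3) by (auto intro: conn_trans conn_sym)
    qed
    have "conn E (S - {a}) b c" "conn E (S - {a}) c d" using p by (auto simp: adj_def intro!: conn_edge)
    then have "conn E (S - {a}) b d" by (rule conn_trans)
    then have ad: "\<not> adj a d" using forest_neighbors_not_conn[OF S, of a b d] p by (auto simp: adj_def)
    have ac: "\<not> adj a c" using tri[of a b c] p by auto
    have bd: "\<not> adj b d" using tri[of b c d] p by auto
    show thesis
    proof (rule that[of a b c d])
      show "S \<subseteq> {a, b, c, d} \<union> non_neighbors V E a b \<union> non_neighbors V E c d"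
      proof (rule ccontr)
        assume "\<not> ?thesis"
        then obtain z where z: "z \<in> S" "z \<notin> {a, b, c, d}" "z \<notin> non_neighbors V E a b" "z \<notin> non_neighbors V E c d"
          by blast
        then obtain p' q where pq: "p' \<in> {a, b}" "q \<in> {c, d}" "adj p' z" "adj q z"
          using SV by (auto simp: nn)
        have "p' \<noteq> q" "p' \<in> S" "q \<in> S" "p' \<noteq> z" "q \<noteq> z" using pq p z by auto
        then show False
          using forest_neighbors_not_conn[OF S z(1), of p' q] conn_rest[OF z(2) pq(1,2)] pq(3,4)
          by (auto simp: adj_def insert_commute)
      qed
      show "d \<in> non_neighbors V E a b" "a \<in> non_neighbors V E c d"
        using p SV ad ac bd by (auto simp: nn sym[of c a] sym[of d a])
    qed (use p ac in \<open>auto simp: adj_def\<close>)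
  next
    case False
    then have np: False if "distinct [a, b, c, d]" "{a, b, c, d} \<subseteq> S" "adj a b" "adj b c" "adj c d"
      for a b c d using that by blast
    have ab: "adj a b" "adj b a" "adj c d" "adj d c" using abcd sym by (auto simp: adj_def)
    \<comment> \<open>An edge between the two given edges would produce a path on four vertices,
      which is excluded here. So would a vertex \<open>z\<close> adjacent to both, as third vertex
      of such a path.\<close>
    have "\<not> adj a c" using np[of b a c d] abcd ab by auto
    moreover have "\<not> adj a d" using np[of b a d c] abcd ab by auto
    moreover have "\<not> adj b c" using np[of a b c d] abcd ab by auto
    moreover have "\<not> adj b d" using np[of a b d c] abcd ab by auto
    ultimately have no: "\<not> adj a c" "\<not> adj a d" "\<not> adj b d" "\<not> adj c a" "\<not> adj d a"
      using sym by auto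
    show thesis
    proof (rule that[of a b c d])
      show "S \<subseteq> {a, b, c, d} \<union> non_neighbors V E a b \<union> non_neighbors V E c d"
      proof (rule ccontr)
        assume "\<not> ?thesis"
        then obtain z where z: "z \<in> S" "z \<notin> {a, b, c, d}" "z \<notin> non_neighbors V E a b" "z \<notin> non_neighbors V E c d"
          by blast
        then obtain q where q: "q \<in> {c, d}" "adj z q" using SV sym by (auto simp: nn)
        have "adj a z \<or> adj b z" using z SV by (auto simp: nn)
        then show False
          using np[of b a z q] np[of a b z q] abcd ab q z by auto
      qed
    qed (use abcd SV no in \<open>auto simp: nn, auto simp: adj_def\<close>)
  qed
qed

text \<open>The argument \<open>d\<close> is kept apart from the triple because it will range only
  over the common non-neighbours of \<open>a\<close> and \<open>b\<close>.\<close>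

definition spanned_by_edges :: "'a set \<Rightarrow> 'a set set \<Rightarrow> 'a \<times> 'a \<times> 'a \<Rightarrow> 'a \<Rightarrow> 'a set set" where
  "spanned_by_edges V E = (\<lambda>(a, b, c) d. {S \<in> maximal_extensions E {} V.
     distinct [a, b, c, d] \<and> {a, b, c, d} \<subseteq> S \<and> {a, b} \<in> E \<and> {c, d} \<in> E \<and> {a, c} \<notin> E
     \<and> d \<in> non_neighbors V E a b \<and> a \<in> non_neighbors V E c d
     \<and> S \<subseteq> {a, b, c, d} \<union> non_neighbors V E a b \<union> non_neighbors V E c d})"

text \<open>If \<open>bc\<close> is an edge, \<open>Q\<close> contracts to one vertex and each
  non-neighbourhood loses one element to \<open>Q\<close>, giving \<open>1 + 2 * (k - 1)\<close>.
  Otherwise \<open>Q\<close> contracts to two vertices and each loses two, giving at most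
  \<open>2 + 2 * (k - 2)\<close>.\<close>

lemma card_spanned_by_edges_le:
  assumes finV: "finite V"
    and closed: "\<And>u v. u \<in> V \<Longrightarrow> v \<in> V \<Longrightarrow> {u, v} \<in> E \<Longrightarrow> card (non_neighbors V E u v) \<le> k"
  shows "card (spanned_by_edges V E (a, b, c) d) \<le> F (2 * k - 1)"
proof (cases "spanned_by_edges V E (a, b, c) d = {}")
  case False
  let ?G = "spanned_by_edges V E (a, b, c) d" and ?W = "non_neighbors V E"
  define Q where "Q = {a, b, c, d}"
  define R where "R = ?W a b \<union> ?W c d - Q"
  obtain S where S: "S \<subseteq> V" "induces_forest E S"
    and abcd: "distinct [a, b, c, d]" "{a, b, c, d} \<subseteq> S" "{a, b} \<in> E" "{c, d} \<in> E" "{a, c} \<notin> E"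
      "d \<in> ?W a b" "a \<in> ?W c d"
    using False by (auto simp: spanned_by_edges_def maximal_extensions_def)
  have finW: "finite (?W u v)" for u v using finV by (simp add: non_neighbors_def)
  have finR: "finite R" by (simp add: R_def finW)
  have QR: "finite Q" "Q \<inter> R = {}" by (auto simp: Q_def R_def)
  have kW: "card (?W a b) \<le> k" "card (?W c d) \<le> k" using abcd S by (auto intro!: closed)
  have sub: "?G \<subseteq> maximal_extensions E Q R"
  proof
    fix S' assume S': "S' \<in> ?G"
    have "S' \<subseteq> Q \<union> R" "Q \<subseteq> S'" using S' by (auto simp: spanned_by_edges_def Q_def R_def)
    moreover have "R \<subseteq> V" by (auto simp: R_def non_neighbors_def)
    ultimately show "S' \<in> maximal_extensions E Q R"
      using S' by (auto simp: spanned_by_edges_def maximal_extensions_def)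
  qed
  have forQ: "induces_forest E Q" using S(2) by (rule induces_forest_mono) (use abcd in \<open>auto simp: Q_def\<close>)
  obtain g :: "'a \<Rightarrow> nat" where g: "inj_on g R" using finR by (meson finite_imp_inj_to_nat_seg)
  have cardR: "card R \<le> card (?W a b - X) + card (?W c d - Y)"
    if "X \<subseteq> Q" "Y \<subseteq> Q" for X Y
  proof -
    have "R \<subseteq> (?W a b - X) \<union> (?W c d - Y)" using that by (auto simp: R_def)
    then have "card R \<le> card ((?W a b - X) \<union> (?W c d - Y))" by (intro card_mono) (auto simp: finW)
    then show ?thesis using card_Un_le le_trans by blast
  qed
  have cab: "conn E Q a b" "conn E Q c d" using abcd by (auto simp: Q_def intro: conn_edge)
  have ne: "a \<noteq> b" "a \<noteq> c" "a \<noteq> d" "b \<noteq> c" "b \<noteq> d" "c \<noteq> d" using abcd(1) by auto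
  have "card (maximal_extensions E Q R) \<le> F (2 * k - 1)"
  proof (cases "{b, c} \<in> E")
    case True
    define f where "f x = (if x \<in> Q then 0 else Suc (g x))" for x
    have "conn E Q b c" using True by (auto simp: Q_def intro: conn_edge)
    then have "conn E Q a c" "conn E Q a d" using cab by (meson conn_trans)+
    then have "conn E Q a x" if "x \<in> Q" for x
      using cab(1) that unfolding Q_def by auto
    then have fib: "conn E Q x y" if "x \<in> Q" "y \<in> Q" for x y
      using that by (meson conn_sym conn_trans)
    \<comment> \<open>The nonzero cardinality gives \<open>k\<close> at least 1, so truncated
      subtraction does no harm.\<close>
    have "card (?W a b - {d}) = card (?W a b) - 1" "card (?W c d - {a}) = card (?W c d) - 1"
      "card (?W a b) \<noteq> 0"
      using abcd finW by auto
    then have "1 + card R \<le> 2 * k - 1" using cardR[of "{d}" "{a}"] kW by (auto simp: Q_def)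
    moreover have fQ: "f ` Q = {0}" by (auto simp: f_def Q_def)
    moreover have fR: "f x = Suc (g x)" if "x \<in> R" for x using that by (auto simp: f_def R_def)
    moreover have "f x = f y \<longleftrightarrow> conn E Q x y" if "x \<in> Q" "y \<in> Q" for x y
      using fib[OF that] that by (simp add: f_def)
    moreover have "inj_on f R" using g fR by (simp add: inj_on_def)
    moreover have "f ` Q \<inter> f ` R = {}" unfolding fQ using fR by auto
    ultimately show ?thesis
      using forQ finR QR by (intro card_maximal_extensions_le_F[where f = f]) simp_all
  next
    case False
    define f where "f x = (if x \<in> {a, b} then 0 else if x \<in> {c, d} then 1 else 2 + g x)" for x
    have noedge: "{x, y} \<notin> E" if "x \<in> {a, b}" "y \<in> {c, d}" for x y
      using that False abcd by (auto simp: non_neighbors_def insert_commute)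
    have sep: "\<not> conn E Q x y" if xy: "x \<in> {a, b}" "y \<in> {c, d}" for x y
    proof
      assume "conn E Q x y"
      then obtain u v where "u \<in> {a, b}" "v \<notin> {a, b}" "v \<in> Q" "{u, v} \<in> E"
        by (rule conn_leaves[where C = "{a, b}"]) (use xy ne in auto)
      then show False using noedge by (auto simp: Q_def)
    qed
    have fib: "f x = f y \<longleftrightarrow> conn E Q x y" if xy: "x \<in> Q" "y \<in> Q" for x y
    proof -
      consider "x \<in> {a, b}" "y \<in> {a, b}" | "x \<in> {a, b}" "y \<in> {c, d}" | "x \<in> {c, d}" "y \<in> {a, b}"
        | "x \<in> {c, d}" "y \<in> {c, d}" using xy by (auto simp: Q_def)
      then show ?thesis
      proof cases
        case 1
        then show ?thesis using cab(1) conn_sym[OF cab(1)] by (auto simp: f_def)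
      next
        case 2
        then show ?thesis using sep[OF 2] ne by (auto simp: f_def)
      next
        case 3
        then show ?thesis using sep[OF 3(2,1)] conn_sym[of E Q x y] ne by (auto simp: f_def)
      next
        case 4
        then show ?thesis using cab(2) conn_sym[OF cab(2)] ne by (auto simp: f_def)
      qed
    qed
    have cd: "{c, d} \<subseteq> ?W a b" and ab: "{a, b} \<subseteq> ?W c d"
      using abcd S noedge by (auto simp: non_neighbors_def insert_commute)
    have "card (?W a b - {c, d}) = card (?W a b) - 2" "card (?W c d - {a, b}) = card (?W c d) - 2"
      using cd ab ne by (simp_all add: card_Diff_subset)
    moreover have "2 \<le> card (?W a b)" using card_mono[OF finW cd] ne by simp
    ultimately have "2 + card R \<le> 2 * k - 1"
      using cardR[of "{c, d}" "{a, b}"] kW by (auto simp: Q_def)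
    moreover have fQ: "f ` Q = {0, 1}" using ne by (auto simp: f_def Q_def)
    moreover have fR: "f x = 2 + g x" if "x \<in> R" for x using that by (auto simp: f_def R_def Q_def)
    moreover have "inj_on f R" using g fR by (simp add: inj_on_def)
    moreover have "f ` Q \<inter> f ` R = {}" unfolding fQ using fR by auto
    ultimately show ?thesis
      using forQ finR QR fib by (intro card_maximal_extensions_le_F[where f = f]) simp_all
  qed
  moreover have "card ?G \<le> card (maximal_extensions E Q R)"
    using sub finR by (intro card_mono finite_maximal_extensions) (auto simp: Q_def)
  ultimately show ?thesis by linarith
qed simp

section \<open>Numerical bounds and the final count\<close>

lemma M0_le_pow: "M0 N \<le> 2 ^ N"
proof -
  obtain V :: "nat set" and E where "simple_graph V E" "card V = N"
    "card (maximal_independent_sets V E) = M0 N" by (rule M0_attained)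
  then show ?thesis
    using card_maximal_subsets_le[of V "\<lambda>S. indep S E"]
    by (simp add: simple_graph_def maximal_independent_sets_def)
qed

lemma M0_1: "M0 1 = 1"
proof -
  obtain V :: "nat set" and E where V: "simple_graph V E" "card V = 1"
    "card (maximal_independent_sets V E) = M0 1" by (rule M0_attained)
  obtain x where x: "V = {x}" using V(2) by (meson card_1_singletonE)
  have "maximal_independent_sets V E \<subseteq> {{x}}"
  proof
    fix I assume I: "I \<in> maximal_independent_sets V E"
    have "indep {x} E" by (simp add: indep_def)
    then have "\<not> I \<subset> {x}" using I x by (auto simp: maximal_independent_sets_def maximal_subsets_def)
    then show "I \<in> {{x}}" using I x by (auto simp: maximal_independent_sets_def maximal_subsets_def)
  qed
  then have "M0 1 \<le> 1" using card_mono[of "{{x}}" "maximal_independent_sets V E"] V(3) by simp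
  then show ?thesis using M0_pos[of 1] by linarith
qed

text \<open>For \<open>m\<close> at least 2 the crude bound \<open>2 ^ m\<close> suffices, since
  \<open>2 < 1.8638^2\<close> and the surplus factor 1.8638 is below \<open>m\<close>. For
  \<open>m = 1\<close> it would fail, hence the exact value \<open>M0_1\<close>.\<close>

lemma M0_le:
  assumes "1 \<le> m"
  shows "real (M0 m) \<le> real m * 1.8638 ^ (2 * m - 1)"
proof (cases "m = 1")
  case True
  then show ?thesis using M0_1 by simp
next
  case False
  have "real (M0 m) \<le> 2 ^ m" using M0_le_pow[of m] by (simp flip: of_nat_le_iff)
  also have "\<dots> \<le> (1.8638\<^sup>2 :: real) ^ m" by (intro power_mono) (auto simp: power2_eq_square)
  also have "\<dots> = 1.8638 * 1.8638 ^ (2 * m - 1)"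
  proof -
    have "2 * m = Suc (2 * m - 1)" using assms by simp
    then have "(1.8638 :: real) ^ (2 * m) = 1.8638 * 1.8638 ^ (2 * m - 1)" by (metis power_Suc)
    then show ?thesis by (simp only: power_mult)
  qed
  also have "\<dots> \<le> real m * 1.8638 ^ (2 * m - 1)"
    using assms False by (intro mult_right_mono) auto
  finally show ?thesis .
qed

text \<open>Stars are indexed by their centre \<open>v\<close>, with \<open>n\<close> choices; the
  other forests by \<open>(a, b, c)\<close> and \<open>d\<close>, with at most
  \<open>n ^ 3 * k\<close> choices.\<close>

lemma card_maximal_induced_forests_le_M0_F:
  assumes finV: "finite V" and V: "V \<noteq> {}"
    and closed: "\<And>u v. u \<in> V \<Longrightarrow> v \<in> V \<Longrightarrow> {u, v} \<in> E \<Longrightarrow> card (non_neighbors V E u v) \<le> k"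
  shows "card (maximal_induced_forests V E) \<le> card V ^ 3 * M0 k + card V ^ 3 * k * F (2 * k - 1)"
proof -
  define n where "n = card V"
  have n: "1 \<le> n" using finV V by (simp add: n_def Suc_le_eq card_gt_0_iff)
  let ?M = "maximal_extensions E {} V"
  define A where "A = (\<Union>v\<in>V. insert v ` maximal_independent_sets (V - {v}) E)"
  define X where "X = {(a, b, c). a \<in> V \<and> b \<in> V \<and> c \<in> V \<and> {a, b} \<in> E}"
  define J where "J = (SIGMA (a, b, c):X. non_neighbors V E a b)"
  define B where "B = (\<Union>(t, d)\<in>J. spanned_by_edges V E t d)"
  have finW: "finite (non_neighbors V E u v)" for u v using finV by (simp add: non_neighbors_def)
  have finM: "finite ?M" using finV by (simp add: finite_maximal_extensions)
  have XV: "X \<subseteq> V \<times> V \<times> V" by (auto simp: X_def)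
  have finX: "finite X" by (rule finite_subset[OF XV]) (simp add: finV)
  have finJ: "finite J" unfolding J_def by (intro finite_SigmaI finX) (auto simp: finW)
  have finI: "finite (maximal_independent_sets (V - {v}) E)" for v
    by (rule finite_subset[of _ "Pow V"])
      (use finV in \<open>auto simp: maximal_independent_sets_def maximal_subsets_def\<close>)
  have "?M \<subseteq> A \<union> B"
  proof
    fix S assume S: "S \<in> ?M"
    have S': "S \<subseteq> V" "induces_forest E S" using S by (auto simp: maximal_extensions_def)
    have "S \<noteq> {}"
    proof
      assume "S = {}"
      obtain v where v: "v \<in> V" using V by blast
      have "induces_forest E {v}" by (rule induces_forest_indep) (simp add: indep_def)
      then show False using S v \<open>S = {}\<close> by (auto simp: maximal_extensions_def)
    qed
    show "S \<in> A \<union> B"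
    proof (rule star_or_disjoint_edges[OF S'(2) \<open>S \<noteq> {}\<close>])
      fix v assume v: "v \<in> S" "indep (S - {v}) E"
      have "S - {v} \<in> maximal_independent_sets (V - {v}) E"
        using star_maximal_forest[OF S v] .
      moreover have "S = insert v (S - {v})" using v by auto
      ultimately have "S \<in> insert v ` maximal_independent_sets (V - {v}) E" by (metis imageI)
      then show ?thesis using v S' by (auto simp: A_def)
    next
      fix a b c d
      assume "distinct [a, b, c, d]" "{a, b, c, d} \<subseteq> S" "{a, b} \<in> E" "{c, d} \<in> E"
      from two_edges_dominate[OF S'(2) this S'(1)]
      obtain a b c d where abcd: "distinct [a, b, c, d]" "{a, b, c, d} \<subseteq> S" "{a, b} \<in> E" "{c, d} \<in> E"
        "{a, c} \<notin> E" "d \<in> non_neighbors V E a b" "a \<in> non_neighbors V E c d"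
        "S \<subseteq> {a, b, c, d} \<union> non_neighbors V E a b \<union> non_neighbors V E c d" .
      then have "S \<in> spanned_by_edges V E (a, b, c) d" using S by (simp add: spanned_by_edges_def)
      moreover have "((a, b, c), d) \<in> J" using abcd S' by (auto simp: J_def X_def)
      ultimately show ?thesis unfolding B_def by blast
    qed
  qed
  moreover have "finite A" unfolding A_def by (intro finite_UN_I finite_imageI finV finI)
  moreover have "finite B"
    by (rule finite_subset[OF _ finM]) (auto simp: B_def spanned_by_edges_def)
  ultimately have "card ?M \<le> card A + card B"
    by (meson card_Un_le card_mono finite_UnI le_trans)
  moreover have "card A \<le> n ^ 3 * M0 k"
  proof -
    have "card A \<le> (\<Sum>v\<in>V. card (insert v ` maximal_independent_sets (V - {v}) E))"
      unfolding A_def by (rule card_UN_le[OF finV])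
    also have "\<dots> \<le> (\<Sum>v\<in>V. n\<^sup>2 * M0 k)"
    proof (rule sum_mono)
      fix v assume v: "v \<in> V"
      have "card (insert v ` maximal_independent_sets (V - {v}) E)
          \<le> card (maximal_independent_sets (V - {v}) E)"
        by (rule card_image_le[OF finI])
      also have "\<dots> \<le> (1 + (card (V - {v}))\<^sup>2) * M0 k"
        by (rule card_maximal_independent_sets_le[OF finV _ closed]) auto
      also have "card (V - {v}) = n - 1" using v finV by (simp add: n_def)
      \<comment> \<open>Deleting the centre leaves \<open>n - 1\<close> vertices, which absorbs the
        extra summand 1.\<close>
      also have "(1 + (n - 1)\<^sup>2) * M0 k \<le> n\<^sup>2 * M0 k"
      proof (rule mult_right_mono)
        obtain m where "n = Suc m" using n by (cases n) auto
        then show "1 + (n - 1)\<^sup>2 \<le> n\<^sup>2" by (simp add: power2_eq_square)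
      qed simp
      finally show "card (insert v ` maximal_independent_sets (V - {v}) E) \<le> n\<^sup>2 * M0 k" .
    qed
    also have "\<dots> = n ^ 3 * M0 k" by (simp add: n_def power2_eq_square power3_eq_cube)
    finally show ?thesis .
  qed
  moreover have "card B \<le> n ^ 3 * k * F (2 * k - 1)"
  proof -
    have "card J = (\<Sum>t\<in>X. card (case t of (a, b, c) \<Rightarrow> non_neighbors V E a b))"
      unfolding J_def by (rule card_SigmaI) (use finX finW in \<open>auto split: prod.splits\<close>)
    also have "\<dots> \<le> (\<Sum>t\<in>X. k)"
      by (rule sum_mono) (auto simp: X_def intro: closed)
    also have "\<dots> \<le> n ^ 3 * k"
    proof -
      have "card X \<le> card (V \<times> V \<times> V)" using XV finV by (intro card_mono) auto
      then show ?thesis by (simp add: card_cartesian_product n_def power3_eq_cube)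
    qed
    finally have J: "card J \<le> n ^ 3 * k" .
    have "card B \<le> (\<Sum>p\<in>J. card (case p of (t, d) \<Rightarrow> spanned_by_edges V E t d))"
      unfolding B_def by (rule card_UN_le[OF finJ])
    also have "\<dots> \<le> (\<Sum>p\<in>J. F (2 * k - 1))"
      using card_spanned_by_edges_le[OF finV closed] by (intro sum_mono) auto
    also have "\<dots> \<le> n ^ 3 * k * F (2 * k - 1)" using J by simp
    finally show ?thesis .
  qed
  ultimately show ?thesis
    unfolding maximal_induced_forests_eq_extensions n_def by linarith
qed

theorem theorem34:
  fixes c n :: nat and V :: "'a set" and E H :: "'a set set"
  assumes "c \<ge> 2"
    and "simple_graph V E" and "V \<noteq> {}" and "card V = n"
    and "simple_graph V H" and "c_closed c V H" and "E = complement_edges V H"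
  shows "real (card (maximal_induced_forests V E))
           \<le> real (n ^ 3 * M0 (c - 1) + 2 * n ^ 3 * (c - 1) * F (2 * c - 3))
       \<and> real (n ^ 3 * M0 (c - 1) + 2 * n ^ 3 * (c - 1) * F (2 * c - 3))
           \<le> 3 * real n ^ 3 * real (c - 1) * 1.8638 ^ (2 * c - 3)"
proof
  define k where "k = c - 1"
  have k: "1 \<le> k" "2 * c - 3 = 2 * k - 1" "c - 1 = k" using assms(1) by (auto simp: k_def)
  have "card (non_neighbors V E u v) \<le> k" if "u \<in> V" "v \<in> V" "{u, v} \<in> E" for u v
    using complement_c_closed_iff[OF assms(5,7), of c] assms(6) that
    by (simp add: k_def non_neighbors_def)
  then have "card (maximal_induced_forests V E) \<le> n ^ 3 * M0 k + n ^ 3 * k * F (2 * k - 1)"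
    using card_maximal_induced_forests_le_M0_F[of V E k] assms by (simp add: simple_graph_def)
  also have "\<dots> \<le> n ^ 3 * M0 k + 2 * n ^ 3 * k * F (2 * k - 1)" by simp
  finally show "real (card (maximal_induced_forests V E))
      \<le> real (n ^ 3 * M0 (c - 1) + 2 * n ^ 3 * (c - 1) * F (2 * c - 3))"
    unfolding k by (rule of_nat_mono)
  \<comment> \<open>The factor 3 is one share from the independent sets and two from the
    \<open>F\<close> term.\<close>
  have "real (n ^ 3) * real (M0 k) \<le> real (n ^ 3) * (real k * 1.8638 ^ (2 * k - 1))"
    by (intro mult_left_mono M0_le k(1)) simp
  moreover have "real (2 * n ^ 3 * k) * real (F (2 * k - 1)) \<le> real (2 * n ^ 3 * k) * 1.8638 ^ (2 * k - 1)"
    by (intro mult_left_mono F_le) simp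
  ultimately show "real (n ^ 3 * M0 (c - 1) + 2 * n ^ 3 * (c - 1) * F (2 * c - 3))
      \<le> 3 * real n ^ 3 * real (c - 1) * 1.8638 ^ (2 * c - 3)"
    unfolding k by (simp add: algebra_simps)
qed

end
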